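(* Let $\mathsf{PHey}$ be the category of prelinear Heyting algebras with algebra homomorphisms and $\mathsf{PHil_0}$ the category of bounded prelinear Hilbert algebras with algebra homomorphisms (preserving $\to,1,0$). Let $\mathrm{U}:\mathsf{PHey}\to\mathsf{PHil_0}$ be the forgetful functor. Then the functor $(\ )^*:\mathsf{PHil_0}\to\mathsf{PHey}$, $H\mapsto H^*$, $f\mapsto f^*$ (as defined in the context), is left adjoint to $\mathrm{U}$.
   Context: A Hilbert algebra is an algebra $(H,\to,1)$ of type $(2,0)$ such that for all $a,b,c\in H$: $a\to(b\to a)=1$; $(a\to(b\to c))\to((a\to b)\to(a\to c))=1$; and $a\to b=b\to a=1$ implies $a=b$. Its natural order is $a\le b$ iff $a\to b=1$. A Hilbert chain is a Hilbert algebra whose natural order is total; a prelinear Hilbert algebra is a member of the variety generated by the Hilbert chains. A bounded (prelinear) Hilbert algebra is $(H,\to,1,0)$ with $(H,\to,1)$ a (prelinear) Hilbert algebra and $0\le a$ for all $a$. A prelinear Heyting algebra (Gödel algebra) is a Heyting algebra satisfying $(x\to y)\vee(y\to x)=1$. The forgetful functor $\mathrm{U}$ sends a prelinear Heyting algebra to its reduct $(\to,1,0)$. An implicative filter of a Hilbert algebra $H$ is a subset $F$ with $1\in F$ and such that $a\in F$ and $a\to b\in F$ imply $b\in F$. It is irreducible if $F\neq H$ and whenever $F=F_1\cap F_2$ with $F_1,F_2$ implicative filters, then $F=F_1$ or $F=F_2$. $X(H)$ is the set of irreducible implicative filters of $H$ ordered by inclusion. For $a\in H$, $\varphi_H(a)=\{P\in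 X(H): a\in P\}$. $X(H)^+$ is the Heyting algebra of upsets of $(X(H),\subseteq)$ with operations $\cap,\cup,\emptyset,X(H)$ and $U\Rightarrow V=(U\cap V^c]^c$, where $(Y]$ is the downset generated by $Y$ and $^c$ is complement. $H^*$ is the Heyting subalgebra of $X(H)^+$ generated by $\varphi_H(H)$; if $H$ is a bounded prelinear Hilbert algebra, $H^*$ is a prelinear Heyting algebra. For a morphism $f:H\to G$ in $\mathsf{PHil_0}$ let $R_f\subseteq X(G)\times X(H)$ be given by $(P,Q)\in R_f$ iff $f^{-1}(P)\subseteq Q$, and $R_f(P)=\{Q:(P,Q)\in R_f\}$. The homomorphism $f^*:H^*\to G^*$ is $f^*(U)=\{P\in X(G): R_f(P)\subseteq U\}$. *)

theory Defs
  imports "HOL-Algebra.Congruence" "HOL-Library.FuncSet" "HOL-Library.Countable_Set"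
begin

section \<open>Hilbert algebras\<close>

record 'a hilbert = "'a partial_object" +
  himp :: "['a, 'a] \<Rightarrow> 'a" (infixr "\<leadsto>\<index>" 60)
  hone :: 'a ("\<^bold>1\<index>")

locale hilbert_algebra =
  fixes H (structure)
  assumes imp_closed: "\<lbrakk>a \<in> carrier H; b \<in> carrier H\<rbrakk> \<Longrightarrow> a \<leadsto> b \<in> carrier H"
    and one_closed: "\<^bold>1 \<in> carrier H"
    and imp_K: "\<lbrakk>a \<in> carrier H; b \<in> carrier H\<rbrakk> \<Longrightarrow> a \<leadsto> (b \<leadsto> a) = \<^bold>1"
    and imp_S: "\<lbrakk>a \<in> carrier H; b \<in> carrier H; c \<in> carrier H\<rbrakk> \<Longrightarrow>
      (a \<leadsto> (b \<leadsto> c)) \<leadsto> ((a \<leadsto> b) \<leadsto> (a \<leadsto> c)) = \<^bold>1"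
    and imp_antisym: "\<lbrakk>a \<in> carrier H; b \<in> carrier H; a \<leadsto> b = \<^bold>1; b \<leadsto> a = \<^bold>1\<rbrakk> \<Longrightarrow> a = b"

definition hle :: "('a, 'm) hilbert_scheme \<Rightarrow> 'a \<Rightarrow> 'a \<Rightarrow> bool" where
  "hle H a b \<longleftrightarrow> a \<leadsto>\<^bsub>H\<^esub> b = \<^bold>1\<^bsub>H\<^esub>"

locale hilbert_chain = hilbert_algebra +
  assumes total: "\<lbrakk>a \<in> carrier H; b \<in> carrier H\<rbrakk> \<Longrightarrow> hle H a b \<or> hle H b a"

subsection \<open>The variety generated by the Hilbert chains\<close>

datatype hterm = HVar nat | HOne | HImp hterm hterm

primrec hterm_val :: "('a, 'm) hilbert_scheme \<Rightarrow> (nat \<Rightarrow> 'a) \<Rightarrow> hterm \<Rightarrow> 'a" where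
  "hterm_val H v (HVar n) = v n"
| "hterm_val H v HOne = \<^bold>1\<^bsub>H\<^esub>"
| "hterm_val H v (HImp s t) = hterm_val H v s \<leadsto>\<^bsub>H\<^esub> hterm_val H v t"

definition satisfies_identity :: "('a, 'm) hilbert_scheme \<Rightarrow> hterm \<times> hterm \<Rightarrow> bool" where
  "satisfies_identity H e \<longleftrightarrow>
    (\<forall>v. range v \<subseteq> carrier H \<longrightarrow> hterm_val H v (fst e) = hterm_val H v (snd e))"

text \<open>The identities valid in all Hilbert chains. A definition cannot quantify over all types, so the
  chains range over those whose carrier is a set of natural numbers; this loses nothing, because an
  identity that fails in some chain already fails in a countable subalgebra of it. The lemma
  \<open>chain_identities_valid\<close> below confirms it for chains over an arbitrary type.\<close>

definition chain_identities :: "(hterm \<times> hterm) set" where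
  "chain_identities = {e. \<forall>C :: nat hilbert. hilbert_chain C \<longrightarrow> satisfies_identity C e}"

lemma hterm_val_closed:
  assumes "hilbert_algebra H" and "range v \<subseteq> carrier H"
  shows "hterm_val H v t \<in> carrier H"
  using assms by (induction t) (auto simp: hilbert_algebra.imp_closed hilbert_algebra.one_closed)

instance hterm :: countable by countable_datatype

lemma chain_identities_valid:
  fixes C :: "('a, 'm) hilbert_scheme"
  assumes C: "hilbert_chain C" and e: "e \<in> chain_identities"
  shows "satisfies_identity C e"
  unfolding satisfies_identity_def
proof (intro allI impI)
  fix v :: "nat \<Rightarrow> 'a"
  assume v: "range v \<subseteq> carrier C"
  interpret C: hilbert_chain C by fact
  define S where "S = range (hterm_val C v)"
  have S_sub: "S \<subseteq> carrier C"
    unfolding S_def using hterm_val_closed[OF C.hilbert_algebra_axioms v] by auto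
  have S_imp: "x \<leadsto>\<^bsub>C\<^esub> y \<in> S" if "x \<in> S" "y \<in> S" for x y
  proof -
    from that obtain s t where "x = hterm_val C v s" "y = hterm_val C v t"
      unfolding S_def by blast
    then have "x \<leadsto>\<^bsub>C\<^esub> y = hterm_val C v (HImp s t)" by simp
    then show ?thesis unfolding S_def by (rule range_eqI)
  qed
  have S_one: "\<^bold>1\<^bsub>C\<^esub> \<in> S"
    unfolding S_def by (rule range_eqI[of _ _ HOne]) simp
  have S_var: "v n \<in> S" for n
    unfolding S_def by (rule range_eqI[of _ _ "HVar n"]) simp
  have "countable S" unfolding S_def by blast
  then obtain g :: "'a \<Rightarrow> nat" where g: "inj_on g S" by (rule countableE)
  define k where "k = the_inv_into S g"
  have kg: "k (g x) = x" if "x \<in> S" for x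
    unfolding k_def using the_inv_into_f_f[OF g that] .
  define D :: "nat hilbert" where
    "D = \<lparr>carrier = g ` S, himp = (\<lambda>m n. g (k m \<leadsto>\<^bsub>C\<^esub> k n)), hone = g \<^bold>1\<^bsub>C\<^esub>\<rparr>"
  have g_eq: "g x = g y \<longleftrightarrow> x = y" if "x \<in> S" "y \<in> S" for x y
    using g that by (auto dest: inj_onD)
  have in_C: "x \<in> carrier C" if "x \<in> S" for x using S_sub that by blast
  have "hilbert_chain D"
  proof
    fix a b assume "a \<in> carrier D" "b \<in> carrier D"
    then obtain x y where xy: "a = g x" "b = g y" "x \<in> S" "y \<in> S"
      by (auto simp: D_def)
    then show "hle D a b \<or> hle D b a"
      using C.total[OF in_C in_C, OF xy(3,4)] by (auto simp: D_def hle_def kg)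
  next
    fix a b assume "a \<in> carrier D" "b \<in> carrier D" 
      and ab: "a \<leadsto>\<^bsub>D\<^esub> b = \<^bold>1\<^bsub>D\<^esub>" "b \<leadsto>\<^bsub>D\<^esub> a = \<^bold>1\<^bsub>D\<^esub>"
    then obtain x y where xy: "a = g x" "b = g y" "x \<in> S" "y \<in> S"
      by (auto simp: D_def)
    have "g (x \<leadsto>\<^bsub>C\<^esub> y) = g \<^bold>1\<^bsub>C\<^esub>" "g (y \<leadsto>\<^bsub>C\<^esub> x) = g \<^bold>1\<^bsub>C\<^esub>"
      using ab xy by (simp_all add: D_def kg)
    then have "x \<leadsto>\<^bsub>C\<^esub> y = \<^bold>1\<^bsub>C\<^esub>" "y \<leadsto>\<^bsub>C\<^esub> x = \<^bold>1\<^bsub>C\<^esub>"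
      using xy S_imp S_one by (simp_all add: g_eq)
    then show "a = b" using C.imp_antisym[OF in_C in_C, OF xy(3,4)] xy by simp
  qed (auto simp: D_def kg S_imp S_one in_C C.imp_K C.imp_S)
  then have sat: "satisfies_identity D e" using e by (simp add: chain_identities_def)
  have val: "hterm_val D (g \<circ> v) t = g (hterm_val C v t)" for t
    by (induction t) (simp_all add: D_def kg S_def)
  have "range (g \<circ> v) \<subseteq> carrier D" using S_var by (auto simp: D_def)
  with sat have "hterm_val D (g \<circ> v) (fst e) = hterm_val D (g \<circ> v) (snd e)"
    by (simp only: satisfies_identity_def)
  then have "g (hterm_val C v (fst e)) = g (hterm_val C v (snd e))"
    by (simp only: val)
  then show "hterm_val C v (fst e) = hterm_val C v (snd e)"
    by (rule inj_onD[OF g]) (simp_all add: S_def)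
qed

locale prelinear_hilbert_algebra = hilbert_algebra +
  assumes chain_identity: "e \<in> chain_identities \<Longrightarrow> satisfies_identity H e"

record 'a bounded_hilbert = "'a hilbert" +
  hzero :: 'a ("\<^bold>0\<index>")

locale bounded_prelinear_hilbert_algebra = prelinear_hilbert_algebra H
  for H :: "('a, 'm) bounded_hilbert_scheme" (structure) +
  assumes zero_closed: "\<^bold>0 \<in> carrier H"
    and zero_least: "a \<in> carrier H \<Longrightarrow> hle H \<^bold>0 a"

text \<open>Morphisms are extensional functions on the carrier, so that equality of morphisms is
  equality of functions; composition and identities are those of the library theory
  \<open>FuncSet\<close>.\<close>

definition phil_hom :: "('a, 'm) bounded_hilbert_scheme \<Rightarrow> ('b, 'n) bounded_hilbert_scheme \<Rightarrow> ('a \<Rightarrow> 'b) set" where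
  "phil_hom H K = {f \<in> carrier H \<rightarrow>\<^sub>E carrier K.
     (\<forall>a\<in>carrier H. \<forall>b\<in>carrier H. f (a \<leadsto>\<^bsub>H\<^esub> b) = f a \<leadsto>\<^bsub>K\<^esub> f b) \<and>
     f \<^bold>1\<^bsub>H\<^esub> = \<^bold>1\<^bsub>K\<^esub> \<and> f \<^bold>0\<^bsub>H\<^esub> = \<^bold>0\<^bsub>K\<^esub>}"

abbreviation id_hom :: "('a, 'm) partial_object_scheme \<Rightarrow> 'a \<Rightarrow> 'a" where
  "id_hom A \<equiv> \<lambda>x\<in>carrier A. x"

section \<open>Heyting algebras\<close>

record 'a heyting = "'a bounded_hilbert" +
  hmeet :: "['a, 'a] \<Rightarrow> 'a" (infixl "\<sqinter>\<index>" 70)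
  hjoin :: "['a, 'a] \<Rightarrow> 'a" (infixl "\<squnion>\<index>" 65)

locale heyting_algebra =
  fixes A :: "('a, 'm) heyting_scheme" (structure)
  assumes imp_closed: "\<lbrakk>x \<in> carrier A; y \<in> carrier A\<rbrakk> \<Longrightarrow> x \<leadsto> y \<in> carrier A"
    and meet_closed: "\<lbrakk>x \<in> carrier A; y \<in> carrier A\<rbrakk> \<Longrightarrow> x \<sqinter> y \<in> carrier A"
    and join_closed: "\<lbrakk>x \<in> carrier A; y \<in> carrier A\<rbrakk> \<Longrightarrow> x \<squnion> y \<in> carrier A"
    and one_closed: "\<^bold>1 \<in> carrier A"
    and zero_closed: "\<^bold>0 \<in> carrier A"
    and meet_comm: "\<lbrakk>x \<in> carrier A; y \<in> carrier A\<rbrakk> \<Longrightarrow> x \<sqinter> y = y \<sqinter> x"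
    and join_comm: "\<lbrakk>x \<in> carrier A; y \<in> carrier A\<rbrakk> \<Longrightarrow> x \<squnion> y = y \<squnion> x"
    and meet_assoc: "\<lbrakk>x \<in> carrier A; y \<in> carrier A; z \<in> carrier A\<rbrakk> \<Longrightarrow> x \<sqinter> y \<sqinter> z = x \<sqinter> (y \<sqinter> z)"
    and join_assoc: "\<lbrakk>x \<in> carrier A; y \<in> carrier A; z \<in> carrier A\<rbrakk> \<Longrightarrow> x \<squnion> y \<squnion> z = x \<squnion> (y \<squnion> z)"
    and meet_absorb: "\<lbrakk>x \<in> carrier A; y \<in> carrier A\<rbrakk> \<Longrightarrow> x \<sqinter> (x \<squnion> y) = x"
    and join_absorb: "\<lbrakk>x \<in> carrier A; y \<in> carrier A\<rbrakk> \<Longrightarrow> x \<squnion> (x \<sqinter> y) = x"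
    and meet_one: "x \<in> carrier A \<Longrightarrow> x \<sqinter> \<^bold>1 = x"
    and join_zero: "x \<in> carrier A \<Longrightarrow> x \<squnion> \<^bold>0 = x"
    \<comment> \<open>residuation, with the lattice order \<open>u \<le> w\<close> written as \<open>u \<sqinter> w = u\<close>\<close>
    and residuation: "\<lbrakk>x \<in> carrier A; y \<in> carrier A; z \<in> carrier A\<rbrakk> \<Longrightarrow>
      (z \<sqinter> x) \<sqinter> y = z \<sqinter> x \<longleftrightarrow> z \<sqinter> (x \<leadsto> y) = z"

locale prelinear_heyting_algebra = heyting_algebra +
  assumes prelinear: "\<lbrakk>x \<in> carrier A; y \<in> carrier A\<rbrakk> \<Longrightarrow> (x \<leadsto> y) \<squnion> (y \<leadsto> x) = \<^bold>1"

definition phey_hom :: "('a, 'm) heyting_scheme \<Rightarrow> ('b, 'n) heyting_scheme \<Rightarrow> ('a \<Rightarrow> 'b) set" where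
  "phey_hom A B = {h \<in> carrier A \<rightarrow>\<^sub>E carrier B.
     (\<forall>x\<in>carrier A. \<forall>y\<in>carrier A. h (x \<sqinter>\<^bsub>A\<^esub> y) = h x \<sqinter>\<^bsub>B\<^esub> h y \<and>
        h (x \<squnion>\<^bsub>A\<^esub> y) = h x \<squnion>\<^bsub>B\<^esub> h y \<and> h (x \<leadsto>\<^bsub>A\<^esub> y) = h x \<leadsto>\<^bsub>B\<^esub> h y) \<and>
     h \<^bold>1\<^bsub>A\<^esub> = \<^bold>1\<^bsub>B\<^esub> \<and> h \<^bold>0\<^bsub>A\<^esub> = \<^bold>0\<^bsub>B\<^esub>}"

definition forget :: "'a heyting \<Rightarrow> 'a bounded_hilbert" where
  "forget A = bounded_hilbert.truncate A"

definition forget_hom :: "('a \<Rightarrow> 'b) \<Rightarrow> 'a \<Rightarrow> 'b" where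
  "forget_hom h = h"

inductive_set heyting_generated :: "('a, 'm) heyting_scheme \<Rightarrow> 'a set \<Rightarrow> 'a set"
  for A :: "('a, 'm) heyting_scheme" (structure) and S :: "'a set" where
  gen: "x \<in> S \<Longrightarrow> x \<in> heyting_generated A S"
| one: "\<^bold>1 \<in> heyting_generated A S"
| zero: "\<^bold>0 \<in> heyting_generated A S"
| meet: "\<lbrakk>x \<in> heyting_generated A S; y \<in> heyting_generated A S\<rbrakk> \<Longrightarrow> x \<sqinter> y \<in> heyting_generated A S"
| join: "\<lbrakk>x \<in> heyting_generated A S; y \<in> heyting_generated A S\<rbrakk> \<Longrightarrow> x \<squnion> y \<in> heyting_generated A S"
| imp: "\<lbrakk>x \<in> heyting_generated A S; y \<in> heyting_generated A S\<rbrakk> \<Longrightarrow> x \<leadsto> y \<in> heyting_generated A S"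

lemma id_hom_phil: "bounded_prelinear_hilbert_algebra H \<Longrightarrow> id_hom H \<in> phil_hom H H"
  by (auto simp: phil_hom_def bounded_prelinear_hilbert_algebra_def
      bounded_prelinear_hilbert_algebra_axioms_def prelinear_hilbert_algebra_def
      hilbert_algebra.imp_closed hilbert_algebra.one_closed)

lemma compose_phil:
  assumes "bounded_prelinear_hilbert_algebra H" "f \<in> phil_hom H K" "g \<in> phil_hom K L"
  shows "compose (carrier H) g f \<in> phil_hom H L"
proof -
  interpret bounded_prelinear_hilbert_algebra H by fact
  have f: "f a \<in> carrier K" if "a \<in> carrier H" for a
    using assms(2) that by (auto simp: phil_hom_def)
  show ?thesis
    unfolding phil_hom_def[of H L]
  proof (intro CollectI conjI ballI)
    show "compose (carrier H) g f \<in> carrier H \<rightarrow>\<^sub>E carrier L"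
      using assms(3) f by (auto simp: phil_hom_def compose_def)
  qed (use assms(2,3) f imp_closed one_closed zero_closed in \<open>simp_all add: phil_hom_def compose_def\<close>)
qed

lemma id_hom_phey: "prelinear_heyting_algebra A \<Longrightarrow> id_hom A \<in> phey_hom A A"
  by (auto simp: phey_hom_def prelinear_heyting_algebra_def heyting_algebra.imp_closed
      heyting_algebra.meet_closed heyting_algebra.join_closed heyting_algebra.one_closed
      heyting_algebra.zero_closed)

lemma compose_phey:
  assumes "prelinear_heyting_algebra A" "f \<in> phey_hom A B" "g \<in> phey_hom B D"
  shows "compose (carrier A) g f \<in> phey_hom A D"
proof -
  interpret prelinear_heyting_algebra A by fact
  have f: "f a \<in> carrier B" if "a \<in> carrier A" for a
    using assms(2) that by (auto simp: phey_hom_def)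
  show ?thesis
    unfolding phey_hom_def[of A D]
  proof (intro CollectI conjI ballI)
    show "compose (carrier A) g f \<in> carrier A \<rightarrow>\<^sub>E carrier D"
      using assms(3) f by (auto simp: phey_hom_def compose_def)
  qed (use assms(2,3) f imp_closed meet_closed join_closed one_closed zero_closed
      in \<open>simp_all add: phey_hom_def compose_def\<close>)
qed

section \<open>Irreducible implicative filters and the functor\<close>

definition implicative_filter :: "('a, 'm) hilbert_scheme \<Rightarrow> 'a set \<Rightarrow> bool" where
  "implicative_filter H F \<longleftrightarrow> F \<subseteq> carrier H \<and> \<^bold>1\<^bsub>H\<^esub> \<in> F \<and>
     (\<forall>a\<in>carrier H. \<forall>b\<in>carrier H. a \<in> F \<longrightarrow> a \<leadsto>\<^bsub>H\<^esub> b \<in> F \<longrightarrow> b \<in> F)"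

definition irreducible_filters :: "('a, 'm) hilbert_scheme \<Rightarrow> 'a set set" where
  "irreducible_filters H = {F. implicative_filter H F \<and> F \<noteq> carrier H \<and>
     (\<forall>F1 F2. implicative_filter H F1 \<longrightarrow> implicative_filter H F2 \<longrightarrow>
        F = F1 \<inter> F2 \<longrightarrow> F = F1 \<or> F = F2)}"

definition phi :: "('a, 'm) hilbert_scheme \<Rightarrow> 'a \<Rightarrow> 'a set set" where
  "phi H a = {P \<in> irreducible_filters H. a \<in> P}"

definition upset_algebra :: "'a set set \<Rightarrow> 'a set set heyting" where
  "upset_algebra X =
    \<lparr>carrier = {U. U \<subseteq> X \<and> (\<forall>P\<in>U. \<forall>Q\<in>X. P \<subseteq> Q \<longrightarrow> Q \<in> U)},
     himp = (\<lambda>U V. X - {P \<in> X. \<exists>Q\<in>U \<inter> (X - V). P \<subseteq> Q}),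
     hone = X,
     hzero = {},
     hmeet = (\<inter>),
     hjoin = (\<union>)\<rparr>"

definition star :: "('a, 'm) bounded_hilbert_scheme \<Rightarrow> 'a set set heyting" where
  "star H = (let A = upset_algebra (irreducible_filters H) in
     A\<lparr>carrier := heyting_generated A (phi H ` carrier H)\<rparr>)"

definition filter_rel ::
  "('a, 'm) bounded_hilbert_scheme \<Rightarrow> ('b, 'n) bounded_hilbert_scheme \<Rightarrow> ('a \<Rightarrow> 'b) \<Rightarrow> ('b set \<times> 'a set) set" where
  "filter_rel H G f = {(P, Q). P \<in> irreducible_filters G \<and> Q \<in> irreducible_filters H \<and>
     f -` P \<inter> carrier H \<subseteq> Q}"

definition star_hom ::
  "('a, 'm) bounded_hilbert_scheme \<Rightarrow> ('b, 'n) bounded_hilbert_scheme \<Rightarrow> ('a \<Rightarrow> 'b) \<Rightarrow> 'a set set \<Rightarrow> 'b set set" where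
  "star_hom H G f =
    (\<lambda>U\<in>carrier (star H). {P \<in> irreducible_filters G. filter_rel H G f `` {P} \<subseteq> U})"

text \<open>The comparison map from the hom-set of \<open>star H\<close> and \<open>G\<close> to that of \<open>H\<close> and
  \<open>forget G\<close>, i.e. restriction of a Heyting morphism along \<open>phi H\<close>. It is named explicitly because
  \<open>star H\<close> lives over a type different from that of \<open>H\<close>: the categories have to be treated as
  families indexed by the element types, and a family of bijections that is natural across all
  these types can be given as a polymorphic constant but not quantified over.\<close>

definition star_transpose ::
  "('a, 'm) bounded_hilbert_scheme \<Rightarrow> ('a set set \<Rightarrow> 'b) \<Rightarrow> 'a \<Rightarrow> 'b" where
  "star_transpose H h = compose (carrier H) (forget_hom h) (phi H)"

end

theory Submission
  imports Defs
begin

text \<open>The adjunction rests on two facts about the map \<open>phi\<close>: its image generates \<open>star H\<close> by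
  construction, and for \<open>H = forget G\<close> with \<open>G\<close> a prelinear Heyting algebra it is already a Heyting
  isomorphism onto \<open>star (forget G)\<close>. The first makes restriction along \<open>phi\<close> injective on Heyting
  morphisms. The second gives the inverse: a morphism \<open>f\<close> from \<open>H\<close> to \<open>forget G\<close> extends to
  \<open>star_hom\<close> of \<open>f\<close> followed by the inverse of \<open>phi\<close> (\<open>star_transpose_surj\<close>).

  Everything depends on a concrete description of irreducible filters. A Hilbert algebra is prelinear
  exactly if it satisfies \<open>((a \<leadsto> b) \<leadsto> c) \<leadsto> (((b \<leadsto> a) \<leadsto> c) \<leadsto> c) = \<^bold>1\<close>. By this identity a filter
  \<open>P\<close> is the intersection of its enlargements by \<open>a \<leadsto> b\<close> and by \<open>b \<leadsto> a\<close>, so the irreducible filters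
  are the proper filters that contain \<open>a \<leadsto> b\<close> or \<open>b \<leadsto> a\<close> for all \<open>a\<close> and \<open>b\<close>
  (\<open>irreducible_linear\<close>, \<open>linear_irreducible\<close>). The quotient by such a filter is a chain,
  which shows conversely that the identity implies membership in the variety generated by the chains
  (\<open>goedel_prelinear\<close>); this is how reducts of prelinear Heyting algebras are seen to be prelinear.

  The filters above a linear filter form a chain. Thus the irreducible filters are a forest, and their
  upsets satisfy the prelinearity law. Moreover linearity, unlike irreducibility as such, visibly passes
  to preimages under morphisms. This turns the relation attached to a morphism \<open>f\<close> into the map that sends \<open>P\<close>
  to its preimage, and \<open>star_hom\<close> of \<open>f\<close> sends \<open>U\<close> to the set of all \<open>P\<close> whose preimage lies in
  \<open>U\<close>. Unions, intersections and functoriality are then immediate, while implication is preserved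
  because the map is open: a filter above the preimage of \<open>P\<close> is itself the preimage of a filter
  above \<open>P\<close> (\<open>preimage_lifting\<close>). Linearity finally makes the irreducible filters of a Heyting algebra
  prime, and that is why \<open>phi\<close> respects joins there.\<close>

section \<open>Hilbert algebras and their implicative filters\<close>

context hilbert_algebra
begin

text \<open>Modus ponens is not among the axioms. It comes out of antisymmetry once \<open>\<^bold>1\<close> is known to
  be the top, and that follows by applying the first axiom to one of its own instances.\<close>

lemma imp_one:
  assumes "a \<in> carrier H" shows "a \<leadsto> \<^bold>1 = \<^bold>1"
proof (rule imp_antisym)
  have *: "\<^bold>1 \<leadsto> (a \<leadsto> \<^bold>1) = \<^bold>1" using assms by (simp add: imp_K one_closed)
  then show "\<^bold>1 \<leadsto> (a \<leadsto> \<^bold>1) = \<^bold>1" .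
  show "(a \<leadsto> \<^bold>1) \<leadsto> \<^bold>1 = \<^bold>1"
    using imp_K[of "a \<leadsto> \<^bold>1" "\<^bold>1"] * assms by (simp add: imp_closed one_closed)
qed (use assms in \<open>simp_all add: imp_closed one_closed\<close>)

lemma modus_ponens:
  assumes "\<^bold>1 \<leadsto> a = \<^bold>1" "a \<in> carrier H" shows "a = \<^bold>1"
  using imp_antisym[of a "\<^bold>1"] imp_one[of a] assms one_closed by simp

lemma imp_refl:
  assumes a: "a \<in> carrier H" shows "a \<leadsto> a = \<^bold>1"
proof -
  have "\<^bold>1 \<leadsto> (\<^bold>1 \<leadsto> (a \<leadsto> a)) = \<^bold>1"
    using imp_S[of a "a \<leadsto> a" a] imp_K[of a "a \<leadsto> a"] imp_K[of a a] a by (simp add: imp_closed)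
  then show ?thesis using a by (simp add: modus_ponens imp_closed one_closed)
qed

lemma one_imp:
  assumes a: "a \<in> carrier H" shows "\<^bold>1 \<leadsto> a = a"
proof (rule imp_antisym)
  have "\<^bold>1 \<leadsto> (\<^bold>1 \<leadsto> ((\<^bold>1 \<leadsto> a) \<leadsto> a)) = \<^bold>1"
    using imp_S[of "\<^bold>1 \<leadsto> a" "\<^bold>1" a] a by (simp add: imp_refl imp_one imp_closed one_closed)
  then show "(\<^bold>1 \<leadsto> a) \<leadsto> a = \<^bold>1" using a by (simp add: modus_ponens imp_closed one_closed)
qed (use a in \<open>simp_all add: imp_closed one_closed imp_K\<close>)

end

lemma filter_sub: "implicative_filter H F \<Longrightarrow> a \<in> F \<Longrightarrow> a \<in> carrier H"
  by (auto simp: implicative_filter_def)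

lemma filter_one: "implicative_filter H F \<Longrightarrow> \<^bold>1\<^bsub>H\<^esub> \<in> F"
  by (auto simp: implicative_filter_def)

lemma filter_mp:
  "implicative_filter H F \<Longrightarrow> a \<leadsto>\<^bsub>H\<^esub> b \<in> F \<Longrightarrow> a \<in> F \<Longrightarrow> b \<in> carrier H \<Longrightarrow> b \<in> F"
  unfolding implicative_filter_def by blast

context hilbert_algebra
begin

lemma filter_weaken:
  assumes "implicative_filter H F" "b \<in> F" "a \<in> carrier H" shows "a \<leadsto> b \<in> F"
  using filter_mp[OF assms(1) _ assms(2), of "a \<leadsto> b"] imp_K[of b a] assms filter_sub[OF assms(1,2)]
  by (simp add: imp_closed filter_one)

lemma filter_distrib:
  assumes F: "implicative_filter H F" and "a \<leadsto> (b \<leadsto> c) \<in> F" "a \<leadsto> b \<in> F"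
    "a \<in> carrier H" "b \<in> carrier H" "c \<in> carrier H"
  shows "a \<leadsto> c \<in> F"
  using filter_mp[OF F filter_mp[OF F, of "a \<leadsto> (b \<leadsto> c)"], of "a \<leadsto> b" "a \<leadsto> c"] assms
    imp_S[of a b c] filter_one[OF F]
  by (simp add: imp_closed)

lemma filter_trans:
  assumes F: "implicative_filter H F" and "a \<leadsto> b \<in> F" "b \<leadsto> c \<in> F"
    "a \<in> carrier H" "b \<in> carrier H" "c \<in> carrier H"
  shows "a \<leadsto> c \<in> F"
  using filter_distrib[OF F filter_weaken[OF F, of "b \<leadsto> c" a]] assms by simp

lemma filter_refl: "implicative_filter H F \<Longrightarrow> a \<in> carrier H \<Longrightarrow> a \<leadsto> a \<in> F"
  by (simp add: imp_refl filter_one)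

lemma filter_singleton_one: "implicative_filter H {\<^bold>1}"
  unfolding implicative_filter_def by (auto simp: one_closed modus_ponens)

text \<open>This filter is the one generated by \<open>F\<close> and \<open>a\<close>; a single premise \<open>a\<close> is enough for its members
  since implication distributes over itself.\<close>

lemma adjoin_filter:
  assumes F: "implicative_filter H F" and a: "a \<in> carrier H"
  shows "implicative_filter H {c \<in> carrier H. a \<leadsto> c \<in> F}"
  using filter_distrib[OF F _ _ a] filter_one[OF F] a
  by (auto simp: implicative_filter_def imp_one one_closed)

lemma adjoin_superset:
  assumes F: "implicative_filter H F" and a: "a \<in> carrier H"
  shows "F \<subseteq> {c \<in> carrier H. a \<leadsto> c \<in> F}"
  using filter_weaken[OF F _ a] filter_sub[OF F] by auto

text \<open>A filter that is maximal among those avoiding \<open>a\<close> is irreducible: if it is an intersection of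
  two filters, then one of these avoids \<open>a\<close> too.\<close>

lemma irreducible_extension:
  assumes F: "implicative_filter H F" and a: "a \<in> carrier H" "a \<notin> F"
  obtains P where "P \<in> irreducible_filters H" "F \<subseteq> P" "a \<notin> P"
proof -
  let ?Z = "{G. implicative_filter H G \<and> F \<subseteq> G \<and> a \<notin> G}"
  have "\<exists>M\<in>?Z. \<forall>X\<in>?Z. M \<subseteq> X \<longrightarrow> X = M"
  proof (rule subset_Zorn_nonempty)
    show "?Z \<noteq> {}" using F a by blast
    fix C assume C: "C \<noteq> {}" "subset.chain ?Z C"
    then have sub: "\<And>G. G \<in> C \<Longrightarrow> implicative_filter H G \<and> F \<subseteq> G \<and> a \<notin> G"
      by (auto simp: subset_chain_def)
    have "implicative_filter H (\<Union>C)"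
      unfolding implicative_filter_def
    proof (intro conjI ballI impI)
      show "\<Union>C \<subseteq> carrier H" using sub by (auto dest: filter_sub)
      show "\<^bold>1 \<in> \<Union>C" using C(1) sub by (auto dest: filter_one)
      fix x y assume xy: "x \<in> carrier H" "y \<in> carrier H" "x \<in> \<Union>C" "x \<leadsto> y \<in> \<Union>C"
      then obtain G1 G2 where G: "G1 \<in> C" "x \<in> G1" "G2 \<in> C" "x \<leadsto> y \<in> G2" by blast
      with C have "G1 \<subseteq> G2 \<or> G2 \<subseteq> G1" by (auto simp: subset_chain_def)
      then obtain G3 where "G3 \<in> C" "x \<in> G3" "x \<leadsto> y \<in> G3" using G by blast
      then show "y \<in> \<Union>C" using sub filter_mp[of H G3 x y] xy by blast
    qed
    then show "\<Union>C \<in> ?Z" using C(1) sub by blast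
  qed
  then obtain M where MZ: "M \<in> ?Z" and "\<forall>X\<in>?Z. M \<subseteq> X \<longrightarrow> X = M" ..
  then have max: "X = M" if "implicative_filter H X" "F \<subseteq> X" "a \<notin> X" "M \<subseteq> X" for X
    using that by simp
  have M: "implicative_filter H M" "F \<subseteq> M" "a \<notin> M" using MZ by simp_all
  have "M \<in> irreducible_filters H"
    unfolding irreducible_filters_def
  proof (intro CollectI conjI allI impI)
    show "M \<noteq> carrier H" using M a by blast
    fix F1 F2 assume "implicative_filter H F1" "implicative_filter H F2" "M = F1 \<inter> F2"
    then show "M = F1 \<or> M = F2" using max[of F1] max[of F2] M by blast
  qed (fact M)
  with M that show ?thesis by blast
qed

lemma irreducible_avoiding:
  assumes "a \<in> carrier H" "a \<noteq> \<^bold>1"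
  shows "\<exists>P\<in>irreducible_filters H. a \<notin> P"
  by (rule irreducible_extension[OF filter_singleton_one, of a]) (use assms in auto)

lemma irreducible_filterD: "P \<in> irreducible_filters H \<Longrightarrow> implicative_filter H P"
  by (simp add: irreducible_filters_def)

lemma irreducible_cases:
  assumes "P \<in> irreducible_filters H" "implicative_filter H F1" "implicative_filter H F2" "P = F1 \<inter> F2"
  shows "P = F1 \<or> P = F2"
  using assms by (simp add: irreducible_filters_def)

text \<open>The map \<open>phi\<close> turns implication into relative pseudo-complementation of upsets because an
  irreducible filter that omits \<open>a \<leadsto> b\<close> can be enlarged by \<open>a\<close> and still avoid \<open>b\<close>.\<close>

lemma mem_imp_iff:
  assumes P: "P \<in> irreducible_filters H" and ab: "a \<in> carrier H" "b \<in> carrier H"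
  shows "a \<leadsto> b \<in> P \<longleftrightarrow> (\<forall>Q\<in>irreducible_filters H. P \<subseteq> Q \<longrightarrow> a \<in> Q \<longrightarrow> b \<in> Q)"
proof (intro iffI ballI impI)
  fix Q assume "a \<leadsto> b \<in> P" "Q \<in> irreducible_filters H" "P \<subseteq> Q" "a \<in> Q"
  then show "b \<in> Q" using filter_mp[OF irreducible_filterD, of Q a b] ab by blast
next
  note FP = irreducible_filterD[OF P]
  assume R: "\<forall>Q\<in>irreducible_filters H. P \<subseteq> Q \<longrightarrow> a \<in> Q \<longrightarrow> b \<in> Q"
  show "a \<leadsto> b \<in> P"
  proof (rule ccontr)
    assume "a \<leadsto> b \<notin> P"
    then obtain Q where "Q \<in> irreducible_filters H" "{c \<in> carrier H. a \<leadsto> c \<in> P} \<subseteq> Q" "b \<notin> Q"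
      using irreducible_extension[OF adjoin_filter[OF FP ab(1)], of b] ab by auto
    moreover have "a \<in> {c \<in> carrier H. a \<leadsto> c \<in> P}" using filter_refl[OF FP] ab by simp
    ultimately show False using R adjoin_superset[OF FP ab(1)] by blast
  qed
qed

lemma phi_inj: "inj_on (phi H) (carrier H)"
proof (rule inj_onI)
  have le: "a \<leadsto> b = \<^bold>1" if ab: "a \<in> carrier H" "b \<in> carrier H" "phi H a = phi H b" for a b
  proof (rule ccontr)
    assume "a \<leadsto> b \<noteq> \<^bold>1"
    then obtain P where P: "P \<in> irreducible_filters H" "a \<leadsto> b \<notin> P"
      using irreducible_avoiding[of "a \<leadsto> b"] ab imp_closed by blast
    then obtain Q where "Q \<in> irreducible_filters H" "a \<in> Q" "b \<notin> Q"
      using mem_imp_iff ab by blast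
    then have "Q \<in> phi H a" "Q \<notin> phi H b" by (auto simp: phi_def)
    with ab show False by simp
  qed
  fix a b assume "a \<in> carrier H" "b \<in> carrier H" "phi H a = phi H b"
  then show "a = b" by (simp add: imp_antisym le)
qed

end

section \<open>The prelinearity identity\<close>

locale goedel_hilbert_algebra = hilbert_algebra +
  assumes goedel: "\<lbrakk>a \<in> carrier H; b \<in> carrier H; c \<in> carrier H\<rbrakk> \<Longrightarrow>
    ((a \<leadsto> b) \<leadsto> c) \<leadsto> (((b \<leadsto> a) \<leadsto> c) \<leadsto> c) = \<^bold>1"

definition linear_filter :: "('a, 'm) hilbert_scheme \<Rightarrow> 'a set \<Rightarrow> bool" where
  "linear_filter H P \<longleftrightarrow> (\<forall>a\<in>carrier H. \<forall>b\<in>carrier H. a \<leadsto>\<^bsub>H\<^esub> b \<in> P \<or> b \<leadsto>\<^bsub>H\<^esub> a \<in> P)"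

lemma linear_filterD:
  "linear_filter H P \<Longrightarrow> a \<in> carrier H \<Longrightarrow> b \<in> carrier H \<Longrightarrow> a \<leadsto>\<^bsub>H\<^esub> b \<in> P \<or> b \<leadsto>\<^bsub>H\<^esub> a \<in> P"
  by (simp add: linear_filter_def)

text \<open>The identity says that \<open>P\<close> is the intersection of its enlargements by \<open>a \<leadsto> b\<close> and by
  \<open>b \<leadsto> a\<close>, so an irreducible \<open>P\<close> equals one of them.\<close>

lemma (in goedel_hilbert_algebra) irreducible_linear:
  assumes P: "P \<in> irreducible_filters H"
  shows "linear_filter H P"
  unfolding linear_filter_def
proof (intro ballI)
  fix a b assume ab: "a \<in> carrier H" "b \<in> carrier H"
  note FP = irreducible_filterD[OF P]
  let ?E = "\<lambda>x. {c \<in> carrier H. x \<leadsto> c \<in> P}"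
  have cl: "a \<leadsto> b \<in> carrier H" "b \<leadsto> a \<in> carrier H" using ab by (simp_all add: imp_closed)
  have "?E (a \<leadsto> b) \<inter> ?E (b \<leadsto> a) \<subseteq> P"
  proof
    fix c assume c: "c \<in> ?E (a \<leadsto> b) \<inter> ?E (b \<leadsto> a)"
    then have "((b \<leadsto> a) \<leadsto> c) \<leadsto> c \<in> P"
      using filter_mp[OF FP, of "(a \<leadsto> b) \<leadsto> c"] goedel[of a b c] filter_one[OF FP] ab cl
      by (simp add: imp_closed)
    then show "c \<in> P" using filter_mp[OF FP] c by simp
  qed
  with adjoin_superset[OF FP] cl have "P = ?E (a \<leadsto> b) \<inter> ?E (b \<leadsto> a)" by blast
  then have "P = ?E (a \<leadsto> b) \<or> P = ?E (b \<leadsto> a)"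
    by (rule irreducible_cases[OF P adjoin_filter[OF FP cl(1)] adjoin_filter[OF FP cl(2)]])
  moreover have "x \<in> ?E x" if "x \<in> carrier H" for x using that filter_refl[OF FP] by simp
  ultimately show "a \<leadsto> b \<in> P \<or> b \<leadsto> a \<in> P" using cl by blast
qed

lemma (in hilbert_algebra) linear_irreducible:
  assumes "implicative_filter H P" "P \<noteq> carrier H" "linear_filter H P"
  shows "P \<in> irreducible_filters H"
  unfolding irreducible_filters_def
proof (intro CollectI conjI allI impI)
  fix F1 F2 assume F: "implicative_filter H F1" "implicative_filter H F2" "P = F1 \<inter> F2"
  show "P = F1 \<or> P = F2"
  proof (rule ccontr)
    assume "\<not> (P = F1 \<or> P = F2)"
    then obtain a b where ab: "a \<in> F1" "a \<notin> F2" "b \<in> F2" "b \<notin> F1" using F(3) by blast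
    have cl: "a \<in> carrier H" "b \<in> carrier H" by (fact filter_sub[OF F(1) ab(1)], fact filter_sub[OF F(2) ab(3)])
    then show False
      using F(3) ab linear_filterD[OF assms(3) cl] filter_mp[OF F(1), of a b] filter_mp[OF F(2), of b a]
      by blast
  qed
qed (fact assms)+

text \<open>If \<open>a\<close> lies only in \<open>Q\<close> and \<open>b\<close> only in \<open>R\<close>, then \<open>P\<close> contains neither \<open>a \<leadsto> b\<close> nor \<open>b \<leadsto> a\<close>,
  contrary to linearity.\<close>

lemma (in goedel_hilbert_algebra) irreducible_forest:
  assumes P: "P \<in> irreducible_filters H" and Q: "implicative_filter H Q" and R: "implicative_filter H R"
    and sub: "P \<subseteq> Q" "P \<subseteq> R"
  shows "Q \<subseteq> R \<or> R \<subseteq> Q"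
proof (rule ccontr)
  assume "\<not> (Q \<subseteq> R \<or> R \<subseteq> Q)"
  then obtain a b where ab: "a \<in> Q" "a \<notin> R" "b \<in> R" "b \<notin> Q" by blast
  moreover have "a \<in> carrier H" "b \<in> carrier H"
    by (fact filter_sub[OF Q ab(1)], fact filter_sub[OF R ab(3)])
  ultimately show False
    using linear_filterD[OF irreducible_linear[OF P], of a b] filter_mp[OF Q, of a b]
      filter_mp[OF R, of b a] sub by blast
qed

subsection \<open>The identity characterizes prelinear Hilbert algebras\<close>

sublocale prelinear_hilbert_algebra \<subseteq> goedel_hilbert_algebra
proof
  fix a b c assume abc: "a \<in> carrier H" "b \<in> carrier H" "c \<in> carrier H"
  let ?x = "HVar 0" and ?y = "HVar 1" and ?z = "HVar 2"
  let ?e = "(HImp (HImp (HImp ?x ?y) ?z) (HImp (HImp (HImp ?y ?x) ?z) ?z), HOne)"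
  have "?e \<in> chain_identities"
    unfolding chain_identities_def satisfies_identity_def
  proof (intro CollectI allI impI)
    fix C :: "nat hilbert" and v :: "nat \<Rightarrow> nat"
    assume "hilbert_chain C" "range v \<subseteq> carrier C"
    then interpret C: hilbert_chain C by simp
    have v: "v n \<in> carrier C" for n using \<open>range v \<subseteq> carrier C\<close> by blast
    show "hterm_val C v (fst ?e) = hterm_val C v (snd ?e)"
      using C.total[OF v v, of 0 1]
      by (auto simp: hle_def v C.imp_closed C.one_closed C.one_imp C.imp_K C.imp_refl C.imp_one)
  qed
  from chain_identity[OF this] show "((a \<leadsto> b) \<leadsto> c) \<leadsto> (((b \<leadsto> a) \<leadsto> c) \<leadsto> c) = \<^bold>1"
    unfolding satisfies_identity_def
    using abc by (auto dest!: spec[of _ "\<lambda>n::nat. if n = 0 then a else if n = 1 then b else c"])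
qed

definition filter_class :: "('a, 'm) hilbert_scheme \<Rightarrow> 'a set \<Rightarrow> 'a \<Rightarrow> 'a set" where
  "filter_class H P a = {b \<in> carrier H. a \<leadsto>\<^bsub>H\<^esub> b \<in> P \<and> b \<leadsto>\<^bsub>H\<^esub> a \<in> P}"

text \<open>Implication of classes is defined on arbitrary representatives; \<open>filter_quotient_imp\<close> shows that
  the choice does not matter.\<close>

definition filter_quotient :: "('a, 'm) hilbert_scheme \<Rightarrow> 'a set \<Rightarrow> 'a set hilbert" where
  "filter_quotient H P =
    \<lparr>carrier = filter_class H P ` carrier H,
     himp = (\<lambda>X Y. filter_class H P ((SOME x. x \<in> X) \<leadsto>\<^bsub>H\<^esub> (SOME y. y \<in> Y))),
     hone = filter_class H P \<^bold>1\<^bsub>H\<^esub>\<rparr>"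

context hilbert_algebra
begin

lemma filter_class_eq_iff:
  assumes P: "implicative_filter H P" and "a \<in> carrier H" "b \<in> carrier H"
  shows "filter_class H P a = filter_class H P b \<longleftrightarrow> a \<leadsto> b \<in> P \<and> b \<leadsto> a \<in> P"
proof
  assume "filter_class H P a = filter_class H P b"
  moreover have "b \<in> filter_class H P b" using assms by (simp add: filter_class_def filter_refl)
  ultimately have "b \<in> filter_class H P a" by simp
  then show "a \<leadsto> b \<in> P \<and> b \<leadsto> a \<in> P" by (simp add: filter_class_def)
next
  assume "a \<leadsto> b \<in> P \<and> b \<leadsto> a \<in> P"
  then show "filter_class H P a = filter_class H P b"
    unfolding filter_class_def using filter_trans[OF P] assms by blast
qed

lemma filter_imp_mono:
  assumes P: "implicative_filter H P" and "x \<leadsto> a \<in> P" "b \<leadsto> y \<in> P"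
    "a \<in> carrier H" "b \<in> carrier H" "x \<in> carrier H" "y \<in> carrier H"
  shows "(a \<leadsto> b) \<leadsto> (x \<leadsto> y) \<in> P"
proof -
  \<comment> \<open>two transitivity steps, each carried out in the enlargement of \<open>P\<close> by \<open>a \<leadsto> b\<close>\<close>
  let ?E = "{c \<in> carrier H. (a \<leadsto> b) \<leadsto> c \<in> P}"
  have E: "implicative_filter H ?E" and sub: "P \<subseteq> ?E"
    using adjoin_filter[OF P] adjoin_superset[OF P] assms by (simp_all add: imp_closed)
  have "a \<leadsto> b \<in> ?E" using filter_refl[OF P] assms by (simp add: imp_closed)
  moreover have "x \<leadsto> a \<in> ?E" "b \<leadsto> y \<in> ?E" using assms sub by blast+
  ultimately have "x \<leadsto> y \<in> ?E"
    using filter_trans[OF E, of x a b] filter_trans[OF E, of x b y] assms by blast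
  then show ?thesis by simp
qed

lemma filter_quotient_imp:
  assumes P: "implicative_filter H P" and ab: "a \<in> carrier H" "b \<in> carrier H"
  shows "filter_class H P a \<leadsto>\<^bsub>filter_quotient H P\<^esub> filter_class H P b = filter_class H P (a \<leadsto> b)"
proof -
  have rep: "(SOME x. x \<in> filter_class H P c) \<in> filter_class H P c" if "c \<in> carrier H" for c
    by (rule someI[of _ c]) (use that in \<open>simp add: filter_class_def filter_refl[OF P]\<close>)
  define x y where "x = (SOME x. x \<in> filter_class H P a)" and "y = (SOME y. y \<in> filter_class H P b)"
  have "x \<in> filter_class H P a" "y \<in> filter_class H P b" using rep ab by (simp_all add: x_def y_def)
  then have xy: "x \<in> carrier H" "y \<in> carrier H" "a \<leadsto> x \<in> P" "x \<leadsto> a \<in> P" "b \<leadsto> y \<in> P" "y \<leadsto> b \<in> P"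
    by (simp_all add: filter_class_def)
  then have "filter_class H P (x \<leadsto> y) = filter_class H P (a \<leadsto> b)"
    using ab by (simp add: filter_class_eq_iff[OF P] imp_closed filter_imp_mono[OF P])
  then show ?thesis by (simp add: filter_quotient_def x_def y_def)
qed

lemma filter_quotient_chain:
  assumes P: "implicative_filter H P" and lin: "linear_filter H P"
  shows "hilbert_chain (filter_quotient H P)"
proof -
  let ?Q = "filter_quotient H P" and ?c = "filter_class H P"
  have car: "carrier ?Q = ?c ` carrier H" and one: "\<^bold>1\<^bsub>?Q\<^esub> = ?c \<^bold>1"
    by (simp_all add: filter_quotient_def)
  note imp = filter_quotient_imp[OF P]
  have top: "?c a = ?c \<^bold>1 \<longleftrightarrow> a \<in> P" if "a \<in> carrier H" for a
    using that filter_one[OF P] by (simp add: filter_class_eq_iff[OF P] one_closed imp_one one_imp)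
  show ?thesis
  proof
    fix X Y assume "X \<in> carrier ?Q" "Y \<in> carrier ?Q"
    then obtain a b where ab: "X = ?c a" "Y = ?c b" "a \<in> carrier H" "b \<in> carrier H"
      by (auto simp: car)
    then show "hle ?Q X Y \<or> hle ?Q Y X"
      using linear_filterD[OF lin, of a b] by (simp add: hle_def imp one top imp_closed)
  next
    fix X Y assume "X \<in> carrier ?Q" "Y \<in> carrier ?Q" and eq: "X \<leadsto>\<^bsub>?Q\<^esub> Y = \<^bold>1\<^bsub>?Q\<^esub>" "Y \<leadsto>\<^bsub>?Q\<^esub> X = \<^bold>1\<^bsub>?Q\<^esub>"
    then obtain a b where ab: "X = ?c a" "Y = ?c b" "a \<in> carrier H" "b \<in> carrier H"
      by (auto simp: car)
    with eq show "X = Y" by (simp add: imp one top imp_closed filter_class_eq_iff[OF P])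
  qed (auto simp: car one imp imp_closed one_closed imp_K imp_S)
qed

end

text \<open>An identity that fails in the algebra still fails modulo a suitable irreducible filter, and the
  quotient by that filter is a chain. So the algebra is a subdirect product of chains.\<close>

lemma goedel_prelinear:
  fixes H (structure)
  assumes "goedel_hilbert_algebra H"
  shows "prelinear_hilbert_algebra H"
proof -
  interpret goedel_hilbert_algebra H by fact
  have le: "hterm_val H v s \<leadsto> hterm_val H v t = \<^bold>1"
    if e: "(s, t) \<in> chain_identities \<or> (t, s) \<in> chain_identities" and v: "range v \<subseteq> carrier H" for s t v
  proof (rule ccontr)
    have cl: "hterm_val H v r \<in> carrier H" for r
      by (rule hterm_val_closed[OF hilbert_algebra_axioms v])
    assume "hterm_val H v s \<leadsto> hterm_val H v t \<noteq> \<^bold>1"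
    then obtain P where P: "P \<in> irreducible_filters H" "hterm_val H v s \<leadsto> hterm_val H v t \<notin> P"
      using irreducible_avoiding[of "hterm_val H v s \<leadsto> hterm_val H v t"] cl imp_closed
      by metis
    note FP = irreducible_filterD[OF P(1)]
    let ?Q = "filter_quotient H P" and ?w = "filter_class H P \<circ> v"
    have val: "hterm_val ?Q ?w r = filter_class H P (hterm_val H v r)" for r
      by (induction r) (simp_all add: filter_quotient_imp[OF FP] cl, simp add: filter_quotient_def)
    have "hilbert_chain ?Q" by (rule filter_quotient_chain[OF FP irreducible_linear[OF P(1)]])
    then have "satisfies_identity ?Q (s, t) \<or> satisfies_identity ?Q (t, s)"
      using e chain_identities_valid by blast
    moreover have "range ?w \<subseteq> carrier ?Q" using v by (auto simp: filter_quotient_def)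
    ultimately have "hterm_val ?Q ?w s = hterm_val ?Q ?w t"
      by (auto simp: satisfies_identity_def simp del: comp_apply)
    then have "hterm_val H v s \<leadsto> hterm_val H v t \<in> P"
      by (simp add: val filter_class_eq_iff[OF FP] cl)
    with P(2) show False by simp
  qed
  show ?thesis
  proof
    fix e :: "hterm \<times> hterm" assume "e \<in> chain_identities"
    then have "(fst e, snd e) \<in> chain_identities" by simp
    then show "satisfies_identity H e"
      unfolding satisfies_identity_def
      using le hterm_val_closed[OF hilbert_algebra_axioms] by (meson imp_antisym)
  qed
qed

section \<open>The implicative reduct of a Heyting algebra\<close>

context heyting_algebra
begin

abbreviation heyting_le (infix "\<sqsubseteq>" 50) where "x \<sqsubseteq> y \<equiv> x \<sqinter> y = x"

lemma meet_idem: "x \<in> carrier A \<Longrightarrow> x \<sqinter> x = x"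
  using meet_absorb[of x "x \<sqinter> x"] join_absorb[of x x] by (simp add: meet_closed)

lemma le_trans:
  assumes "x \<in> carrier A" "y \<in> carrier A" "z \<in> carrier A" "x \<sqsubseteq> y" "y \<sqsubseteq> z"
  shows "x \<sqsubseteq> z"
  using meet_assoc[of x y z] assms by simp

lemma meet_le2: "x \<in> carrier A \<Longrightarrow> y \<in> carrier A \<Longrightarrow> x \<sqinter> y \<sqsubseteq> y"
  by (simp add: meet_assoc meet_idem)

lemma meet_le1: "x \<in> carrier A \<Longrightarrow> y \<in> carrier A \<Longrightarrow> x \<sqinter> y \<sqsubseteq> x"
  using meet_le2[of y x] by (simp add: meet_comm)

lemma le_join2: "x \<in> carrier A \<Longrightarrow> y \<in> carrier A \<Longrightarrow> y \<sqsubseteq> x \<squnion> y"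
  using meet_absorb[of y x] by (simp add: join_comm)

lemma join_le:
  assumes "x \<in> carrier A" "y \<in> carrier A" "z \<in> carrier A" "x \<sqsubseteq> z" "y \<sqsubseteq> z"
  shows "x \<squnion> y \<sqsubseteq> z"
proof -
  have "u \<squnion> z = z" if "u \<in> carrier A" "u \<sqsubseteq> z" for u
    using join_absorb[of z u] that assms(3) by (simp add: join_comm meet_comm)
  then have "x \<squnion> y \<squnion> z = z" using assms by (simp add: join_assoc)
  then show ?thesis using meet_absorb[of "x \<squnion> y" z] assms by (simp add: join_closed)
qed

lemma le_mp:
  assumes "w \<in> carrier A" "x \<in> carrier A" "y \<in> carrier A" "w \<sqsubseteq> x \<leadsto> y" "w \<sqsubseteq> x"
  shows "w \<sqsubseteq> y"
  using residuation[of x y w] assms by simp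

lemma imp_eq_one_iff:
  assumes "x \<in> carrier A" "y \<in> carrier A"
  shows "x \<leadsto> y = \<^bold>1 \<longleftrightarrow> x \<sqsubseteq> y"
proof -
  have "\<^bold>1 \<sqinter> u = u" if "u \<in> carrier A" for u using that by (simp add: meet_comm one_closed meet_one)
  then show ?thesis using residuation[of x y "\<^bold>1"] assms by (simp add: one_closed imp_closed)
qed

lemma le_imp_iff:
  assumes "x \<in> carrier A" "y \<in> carrier A" "z \<in> carrier A"
  shows "x \<sqsubseteq> y \<leadsto> z \<longleftrightarrow> x \<sqinter> y \<sqsubseteq> z"
  using residuation[of y z x] assms by simp

lemma zero_le: "x \<in> carrier A \<Longrightarrow> \<^bold>0 \<sqsubseteq> x"
  using meet_absorb[of "\<^bold>0" x] join_zero[of x] by (simp add: join_comm zero_closed)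

lemma heyting_imp_K:
  assumes "x \<in> carrier A" "y \<in> carrier A"
  shows "x \<leadsto> (y \<leadsto> x) = \<^bold>1"
  using assms by (simp add: imp_eq_one_iff le_imp_iff meet_le1 imp_closed)

lemma heyting_imp_S:
  assumes x: "x \<in> carrier A" and y: "y \<in> carrier A" and z: "z \<in> carrier A"
  shows "(x \<leadsto> (y \<leadsto> z)) \<leadsto> ((x \<leadsto> y) \<leadsto> (x \<leadsto> z)) = \<^bold>1"
proof -
  let ?p = "x \<leadsto> (y \<leadsto> z)" and ?q = "x \<leadsto> y"
  let ?w = "?p \<sqinter> ?q \<sqinter> x"
  have cl: "?p \<in> carrier A" "?q \<in> carrier A" "y \<leadsto> z \<in> carrier A" "x \<leadsto> z \<in> carrier A"
    "?p \<sqinter> ?q \<in> carrier A" "?w \<in> carrier A"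
    using assms by (simp_all add: imp_closed meet_closed)
  have wx: "?w \<sqsubseteq> x" and wpq: "?w \<sqsubseteq> ?p \<sqinter> ?q" using cl x by (simp_all add: meet_le1 meet_le2)
  have "?w \<sqsubseteq> ?p" "?w \<sqsubseteq> ?q"
    by (rule le_trans[OF cl(6,5,1) wpq], simp add: cl meet_le1,
        rule le_trans[OF cl(6,5,2) wpq], simp add: cl meet_le2)
  then have "?w \<sqsubseteq> y \<leadsto> z" "?w \<sqsubseteq> y" using le_mp[OF cl(6) x] cl y wx by simp_all
  then have "?w \<sqsubseteq> z" using le_mp[OF cl(6) y z] by simp
  then show ?thesis
    using cl x z by (simp add: imp_eq_one_iff le_imp_iff imp_closed)
qed

end

text \<open>Given \<open>w \<sqsubseteq> (x \<leadsto> y) \<leadsto> z\<close> and \<open>w \<sqsubseteq> (y \<leadsto> x) \<leadsto> z\<close>, both \<open>x \<leadsto> y\<close> and \<open>y \<leadsto> x\<close> lie below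
  \<open>w \<leadsto> z\<close>; hence so does their join \<open>\<^bold>1\<close>.\<close>

lemma (in prelinear_heyting_algebra) heyting_goedel:
  assumes x: "x \<in> carrier A" and y: "y \<in> carrier A" and z: "z \<in> carrier A"
  shows "((x \<leadsto> y) \<leadsto> z) \<leadsto> (((y \<leadsto> x) \<leadsto> z) \<leadsto> z) = \<^bold>1"
proof -
  let ?p = "(x \<leadsto> y) \<leadsto> z" and ?q = "(y \<leadsto> x) \<leadsto> z"
  let ?w = "?p \<sqinter> ?q"
  have cl: "x \<leadsto> y \<in> carrier A" "y \<leadsto> x \<in> carrier A" "?p \<in> carrier A" "?q \<in> carrier A" "?w \<in> carrier A"
    using assms by (simp_all add: imp_closed meet_closed)
  have swap: "u \<sqsubseteq> ?w \<leadsto> z" if "?w \<sqsubseteq> u \<leadsto> z" "u \<in> carrier A" for u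
    using that cl z by (simp add: le_imp_iff meet_comm)
  have "x \<leadsto> y \<sqsubseteq> ?w \<leadsto> z" "y \<leadsto> x \<sqsubseteq> ?w \<leadsto> z"
    using swap cl by (simp_all add: meet_le1 meet_le2)
  then have "\<^bold>1 \<sqsubseteq> ?w \<leadsto> z"
    using join_le[of "x \<leadsto> y" "y \<leadsto> x" "?w \<leadsto> z"] prelinear[OF x y] cl z by (simp add: imp_closed)
  then have "?w \<leadsto> z = \<^bold>1"
    using meet_one[of "?w \<leadsto> z"] cl z by (simp add: imp_closed meet_comm one_closed)
  then have "?w \<sqsubseteq> z" using cl z by (simp add: imp_eq_one_iff)
  then show ?thesis using cl z by (simp add: imp_eq_one_iff le_imp_iff imp_closed)
qed

lemma forget_simps [simp]:
  "carrier (forget A) = carrier A" "himp (forget A) = himp A" "\<^bold>1\<^bsub>forget A\<^esub> = \<^bold>1\<^bsub>A\<^esub>" "\<^bold>0\<^bsub>forget A\<^esub> = \<^bold>0\<^bsub>A\<^esub>"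
  by (simp_all add: forget_def bounded_hilbert.truncate_def)

lemma forget_bounded_prelinear:
  assumes "prelinear_heyting_algebra A"
  shows "bounded_prelinear_hilbert_algebra (forget A)"
proof -
  interpret A: prelinear_heyting_algebra A by fact
  have "goedel_hilbert_algebra (forget A)"
  proof
    fix a b assume "a \<in> carrier (forget A)" "b \<in> carrier (forget A)"
      "a \<leadsto>\<^bsub>forget A\<^esub> b = \<^bold>1\<^bsub>forget A\<^esub>" "b \<leadsto>\<^bsub>forget A\<^esub> a = \<^bold>1\<^bsub>forget A\<^esub>"
    then show "a = b" using A.meet_comm[of a b] by (simp add: A.imp_eq_one_iff)
  qed (simp_all add: A.imp_closed A.one_closed A.heyting_imp_K A.heyting_imp_S A.heyting_goedel)
  then interpret prelinear_hilbert_algebra "forget A" by (rule goedel_prelinear)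
  show ?thesis
    by unfold_locales (simp_all add: hle_def A.zero_closed A.imp_eq_one_iff A.zero_le)
qed

section \<open>Algebras of upsets\<close>

lemma upset_carrier:
  "U \<in> carrier (upset_algebra X) \<longleftrightarrow> U \<subseteq> X \<and> (\<forall>P\<in>U. \<forall>Q\<in>X. P \<subseteq> Q \<longrightarrow> Q \<in> U)"
  by (simp add: upset_algebra_def)

lemma upset_ops [simp]:
  "U \<sqinter>\<^bsub>upset_algebra X\<^esub> V = U \<inter> V" "U \<squnion>\<^bsub>upset_algebra X\<^esub> V = U \<union> V"
  "\<^bold>1\<^bsub>upset_algebra X\<^esub> = X" "\<^bold>0\<^bsub>upset_algebra X\<^esub> = {}"
  by (simp_all add: upset_algebra_def)

lemma upset_imp:
  "U \<leadsto>\<^bsub>upset_algebra X\<^esub> V = {P \<in> X. \<forall>Q\<in>X. P \<subseteq> Q \<longrightarrow> Q \<in> U \<longrightarrow> Q \<in> V}"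
  by (auto simp: upset_algebra_def)

lemma upset_algebra_heyting: "heyting_algebra (upset_algebra X)"
proof
  fix U V W
  assume "U \<in> carrier (upset_algebra X)" "V \<in> carrier (upset_algebra X)" "W \<in> carrier (upset_algebra X)"
  then have W: "W \<subseteq> X" "\<And>P Q. P \<in> W \<Longrightarrow> Q \<in> X \<Longrightarrow> P \<subseteq> Q \<Longrightarrow> Q \<in> W"
    by (auto simp: upset_carrier)
  have "W \<inter> U \<subseteq> V \<longleftrightarrow> W \<subseteq> U \<leadsto>\<^bsub>upset_algebra X\<^esub> V"
  proof
    assume "W \<inter> U \<subseteq> V"
    then show "W \<subseteq> U \<leadsto>\<^bsub>upset_algebra X\<^esub> V" using W by (auto simp: upset_imp)
  next
    assume "W \<subseteq> U \<leadsto>\<^bsub>upset_algebra X\<^esub> V"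
    then show "W \<inter> U \<subseteq> V" by (auto simp: upset_imp)
  qed
  then show "W \<sqinter>\<^bsub>upset_algebra X\<^esub> U \<sqinter>\<^bsub>upset_algebra X\<^esub> V = W \<sqinter>\<^bsub>upset_algebra X\<^esub> U \<longleftrightarrow>
      W \<sqinter>\<^bsub>upset_algebra X\<^esub> (U \<leadsto>\<^bsub>upset_algebra X\<^esub> V) = W"
    by (simp only: upset_ops le_iff_inf[symmetric])
next
  fix U V show "U \<leadsto>\<^bsub>upset_algebra X\<^esub> V \<in> carrier (upset_algebra X)"
    unfolding upset_carrier upset_imp by blast
qed (auto simp: upset_carrier)

text \<open>Over a forest, members of \<open>U - V\<close> and of \<open>V - U\<close> above the same \<open>P\<close> would be comparable, which
  upsets \<open>U\<close> and \<open>V\<close> do not allow.\<close>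

lemma upset_algebra_prelinear:
  assumes forest: "\<And>P Q R. \<lbrakk>P \<in> X; Q \<in> X; R \<in> X; P \<subseteq> Q; P \<subseteq> R\<rbrakk> \<Longrightarrow> Q \<subseteq> R \<or> R \<subseteq> Q"
  shows "prelinear_heyting_algebra (upset_algebra X)"
proof -
  interpret heyting_algebra "upset_algebra X" by (rule upset_algebra_heyting)
  show ?thesis
  proof
    fix U V assume UV: "U \<in> carrier (upset_algebra X)" "V \<in> carrier (upset_algebra X)"
    have "P \<in> U \<leadsto>\<^bsub>upset_algebra X\<^esub> V \<or> P \<in> V \<leadsto>\<^bsub>upset_algebra X\<^esub> U" if P: "P \<in> X" for P
    proof (rule ccontr)
      assume "\<not> ?thesis"
      then obtain Q R where QR: "Q \<in> X" "P \<subseteq> Q" "Q \<in> U" "Q \<notin> V" "R \<in> X" "P \<subseteq> R" "R \<in> V" "R \<notin> U"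
        using P unfolding upset_imp by blast
      then have "Q \<subseteq> R \<or> R \<subseteq> Q" using forest P by blast
      then show False using QR UV unfolding upset_carrier by blast
    qed
    then show "(U \<leadsto>\<^bsub>upset_algebra X\<^esub> V) \<squnion>\<^bsub>upset_algebra X\<^esub> (V \<leadsto>\<^bsub>upset_algebra X\<^esub> U) = \<^bold>1\<^bsub>upset_algebra X\<^esub>"
      by (auto simp: upset_imp)
  qed
qed

lemma (in heyting_algebra) heyting_generated_closed:
  assumes "S \<subseteq> carrier A" "x \<in> heyting_generated A S"
  shows "x \<in> carrier A"
  using assms(2)
  by induction (use assms(1) in \<open>auto simp: one_closed zero_closed meet_closed join_closed imp_closed\<close>)

lemma generated_subalgebra_prelinear:
  assumes "prelinear_heyting_algebra A" "S \<subseteq> carrier A"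
  shows "prelinear_heyting_algebra (A\<lparr>carrier := heyting_generated A S\<rparr>)"
proof -
  interpret A: prelinear_heyting_algebra A by fact
  note cl = A.heyting_generated_closed[OF assms(2)]
  show ?thesis
    by unfold_locales
      ((simp add: heyting_generated.intros cl A.meet_assoc A.join_assoc A.meet_absorb A.join_absorb
          A.meet_one A.join_zero A.prelinear; fail)
        | (simp add: cl A.residuation; fail)
        | (simp add: A.meet_comm[OF cl cl]; fail) | (simp add: A.join_comm[OF cl cl]; fail))+
qed

section \<open>The representation by irreducible filters\<close>

lemma star_carrier:
  "carrier (star H) = heyting_generated (upset_algebra (irreducible_filters H)) (phi H ` carrier H)"
  by (simp add: star_def Let_def)

lemma star_ops [simp]:
  "U \<sqinter>\<^bsub>star H\<^esub> V = U \<inter> V" "U \<squnion>\<^bsub>star H\<^esub> V = U \<union> V"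
  "\<^bold>1\<^bsub>star H\<^esub> = irreducible_filters H" "\<^bold>0\<^bsub>star H\<^esub> = {}"
  "himp (star H) = himp (upset_algebra (irreducible_filters H))"
  by (simp_all add: star_def Let_def)

lemma phi_upset: "phi H a \<in> carrier (upset_algebra (irreducible_filters H))"
  by (auto simp: upset_carrier phi_def)

lemma phi_image_upsets: "phi H ` carrier H \<subseteq> carrier (upset_algebra (irreducible_filters H))"
  by (rule image_subsetI) (rule phi_upset)

lemma phi_in_star: "a \<in> carrier H \<Longrightarrow> phi H a \<in> carrier (star H)"
  by (simp add: star_carrier heyting_generated.gen)

lemma star_upset: "U \<in> carrier (star H) \<Longrightarrow> U \<in> carrier (upset_algebra (irreducible_filters H))"
  unfolding star_carrier
  by (rule heyting_algebra.heyting_generated_closed[OF upset_algebra_heyting phi_image_upsets])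

lemma (in goedel_hilbert_algebra) irreducible_upsets_prelinear:
  "prelinear_heyting_algebra (upset_algebra (irreducible_filters H))"
  by (rule upset_algebra_prelinear) (rule irreducible_forest[OF _ irreducible_filterD irreducible_filterD])

lemma star_prelinear:
  assumes "bounded_prelinear_hilbert_algebra H"
  shows "prelinear_heyting_algebra (star H)"
proof -
  interpret bounded_prelinear_hilbert_algebra H by fact
  show ?thesis unfolding star_def Let_def
    by (rule generated_subalgebra_prelinear[OF irreducible_upsets_prelinear phi_image_upsets])
qed

context hilbert_algebra
begin

lemma phi_imp:
  assumes "a \<in> carrier H" "b \<in> carrier H"
  shows "phi H (a \<leadsto> b) = phi H a \<leadsto>\<^bsub>upset_algebra (irreducible_filters H)\<^esub> phi H b"
  using mem_imp_iff[OF _ assms] by (auto simp: phi_def upset_imp)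

lemma phi_one: "phi H \<^bold>1 = irreducible_filters H"
  using filter_one[OF irreducible_filterD] by (auto simp: phi_def)

end

context bounded_prelinear_hilbert_algebra
begin

lemma proper_iff_zero:
  assumes "implicative_filter H F"
  shows "F \<noteq> carrier H \<longleftrightarrow> \<^bold>0 \<notin> F"
  using assms filter_mp[of H F "\<^bold>0"] filter_one[of H F] filter_sub[of H F] zero_least zero_closed
  unfolding hle_def by (metis subsetI subset_antisym)

lemma irreducible_iff:
  "P \<in> irreducible_filters H \<longleftrightarrow> implicative_filter H P \<and> \<^bold>0 \<notin> P \<and> linear_filter H P"
  using irreducible_linear linear_irreducible irreducible_filterD proper_iff_zero
  by (metis (mono_tags, lifting) irreducible_filters_def mem_Collect_eq)

lemma phi_zero: "phi H \<^bold>0 = {}"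
  by (auto simp: phi_def irreducible_iff)

end

lemma phi_unit:
  assumes "bounded_prelinear_hilbert_algebra H"
  shows "restrict (phi H) (carrier H) \<in> phil_hom H (forget (star H))"
proof -
  interpret bounded_prelinear_hilbert_algebra H by fact
  show ?thesis unfolding phil_hom_def
    by (auto simp: phi_in_star imp_closed one_closed zero_closed phi_imp phi_one phi_zero)
qed

section \<open>The action on morphisms\<close>

locale phil_morphism = H: bounded_prelinear_hilbert_algebra H + G: bounded_prelinear_hilbert_algebra G
  for H :: "('a, 'm) bounded_hilbert_scheme" and G :: "('b, 'n) bounded_hilbert_scheme" +
  fixes f
  assumes f: "f \<in> phil_hom H G"
begin

abbreviation preimage :: "'b set \<Rightarrow> 'a set" where "preimage P \<equiv> f -` P \<inter> carrier H"

lemma f_closed: "a \<in> carrier H \<Longrightarrow> f a \<in> carrier G"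
  using f by (auto simp: phil_hom_def)

lemma f_imp: "a \<in> carrier H \<Longrightarrow> b \<in> carrier H \<Longrightarrow> f (a \<leadsto>\<^bsub>H\<^esub> b) = f a \<leadsto>\<^bsub>G\<^esub> f b"
  and f_one: "f \<^bold>1\<^bsub>H\<^esub> = \<^bold>1\<^bsub>G\<^esub>" and f_zero: "f \<^bold>0\<^bsub>H\<^esub> = \<^bold>0\<^bsub>G\<^esub>"
  using f by (simp_all add: phil_hom_def)

text \<open>Irreducibility is not visibly inherited by preimages, but its reformulation as linearity together
  with the absence of \<open>\<^bold>0\<close> is. The relation attached to \<open>f\<close> thereby reduces to a map.\<close>

lemma preimage_irreducible:
  assumes P: "P \<in> irreducible_filters G"
  shows "preimage P \<in> irreducible_filters H"
  unfolding H.irreducible_iff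
proof (intro conjI)
  have FP: "implicative_filter G P" and "\<^bold>0\<^bsub>G\<^esub> \<notin> P" and lin: "linear_filter G P"
    using P by (simp_all add: G.irreducible_iff)
  then show "\<^bold>0\<^bsub>H\<^esub> \<notin> preimage P" by (simp add: f_zero)
  show "implicative_filter H (preimage P)"
    using filter_one[OF FP] filter_mp[OF FP] f_closed
    by (auto simp: implicative_filter_def f_one f_imp H.one_closed)
  show "linear_filter H (preimage P)"
    using linear_filterD[OF lin f_closed f_closed]
    by (auto simp: linear_filter_def H.imp_closed f_imp)
qed

text \<open>The filter \<open>P'\<close> is the one generated by \<open>P\<close> and \<open>f ` Q\<close>. A single element of \<open>Q\<close> suffices as
  a premise for each of its members since modulo \<open>P\<close> the images of two elements are comparable, so
  that the smaller one serves for both.\<close>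

lemma preimage_lifting:
  assumes P: "P \<in> irreducible_filters G" and Q: "Q \<in> irreducible_filters H" and sub: "preimage P \<subseteq> Q"
  shows "\<exists>P'\<in>irreducible_filters G. P \<subseteq> P' \<and> preimage P' = Q"
proof -
  have FP: "implicative_filter G P" and lin: "linear_filter G P" using P by (simp_all add: G.irreducible_iff)
  have FQ: "implicative_filter H Q" and Q0: "\<^bold>0\<^bsub>H\<^esub> \<notin> Q" using Q by (simp_all add: H.irreducible_iff)
  note QH = filter_sub[OF FQ]
  define P' where "P' = {b \<in> carrier G. \<exists>q\<in>Q. f q \<leadsto>\<^bsub>G\<^esub> b \<in> P}"
  have FP': "implicative_filter G P'"
    unfolding implicative_filter_def
  proof (intro conjI ballI impI)
    show "\<^bold>1\<^bsub>G\<^esub> \<in> P'"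
      unfolding P'_def using filter_one[OF FQ] filter_one[OF FP]
      by (auto simp: G.one_closed G.imp_one f_one intro!: bexI[of _ "\<^bold>1\<^bsub>H\<^esub>"])
    fix b c assume bc: "b \<in> carrier G" "c \<in> carrier G" "b \<in> P'" "b \<leadsto>\<^bsub>G\<^esub> c \<in> P'"
    then obtain q r where qr: "q \<in> Q" "r \<in> Q" "f q \<leadsto>\<^bsub>G\<^esub> b \<in> P" "f r \<leadsto>\<^bsub>G\<^esub> (b \<leadsto>\<^bsub>G\<^esub> c) \<in> P"
      by (auto simp: P'_def)
    have cl: "f q \<in> carrier G" "f r \<in> carrier G" using qr QH f_closed by auto
    have "\<exists>s\<in>Q. f s \<leadsto>\<^bsub>G\<^esub> b \<in> P \<and> f s \<leadsto>\<^bsub>G\<^esub> (b \<leadsto>\<^bsub>G\<^esub> c) \<in> P"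
      using linear_filterD[OF lin cl]
    proof
      assume "f q \<leadsto>\<^bsub>G\<^esub> f r \<in> P"
      then show ?thesis using G.filter_trans[OF FP _ qr(4)] cl bc qr G.imp_closed by blast
    next
      assume "f r \<leadsto>\<^bsub>G\<^esub> f q \<in> P"
      then show ?thesis using G.filter_trans[OF FP _ qr(3)] cl bc qr by blast
    qed
    then obtain s where s: "s \<in> Q" "f s \<leadsto>\<^bsub>G\<^esub> b \<in> P" "f s \<leadsto>\<^bsub>G\<^esub> (b \<leadsto>\<^bsub>G\<^esub> c) \<in> P" by blast
    then have "f s \<leadsto>\<^bsub>G\<^esub> c \<in> P" using G.filter_distrib[OF FP s(3,2)] bc QH f_closed by simp
    then show "c \<in> P'" using s bc by (auto simp: P'_def)
  qed (auto simp: P'_def)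
  have PP': "P \<subseteq> P'"
  proof
    fix b assume b: "b \<in> P"
    then have "f \<^bold>1\<^bsub>H\<^esub> \<leadsto>\<^bsub>G\<^esub> b \<in> P" using filter_sub[OF FP b] by (simp add: f_one G.one_imp)
    then show "b \<in> P'" unfolding P'_def using filter_sub[OF FP b] filter_one[OF FQ] by blast
  qed
  have pre: "preimage P' = Q"
  proof (intro equalityI subsetI)
    fix a assume "a \<in> preimage P'"
    then obtain q where q: "q \<in> Q" "f q \<leadsto>\<^bsub>G\<^esub> f a \<in> P" and a: "a \<in> carrier H" by (auto simp: P'_def)
    then have "q \<leadsto>\<^bsub>H\<^esub> a \<in> preimage P" using QH by (simp add: f_imp H.imp_closed)
    then show "a \<in> Q" using filter_mp[OF FQ, of q a] q a sub by blast
  next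
    fix q assume q: "q \<in> Q"
    then show "q \<in> preimage P'"
      using QH[OF q] f_closed[OF QH[OF q]] G.filter_refl[OF FP] by (auto simp: P'_def)
  qed
  have "\<^bold>0\<^bsub>G\<^esub> \<notin> P'" using pre Q0 f_zero H.zero_closed by auto
  moreover have "linear_filter G P'" using lin PP' by (auto simp: linear_filter_def)
  ultimately have "P' \<in> irreducible_filters G" using FP' by (simp add: G.irreducible_iff)
  with PP' pre show ?thesis by blast
qed

lemma star_hom_apply:
  assumes U: "U \<in> carrier (star H)"
  shows "star_hom H G f U = {P \<in> irreducible_filters G. preimage P \<in> U}"
proof -
  have up: "U \<subseteq> irreducible_filters H" "\<And>P Q. P \<in> U \<Longrightarrow> Q \<in> irreducible_filters H \<Longrightarrow> P \<subseteq> Q \<Longrightarrow> Q \<in> U"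
    using star_upset[OF U] by (auto simp: upset_carrier)
  have "filter_rel H G f `` {P} \<subseteq> U \<longleftrightarrow> preimage P \<in> U" if P: "P \<in> irreducible_filters G" for P
  proof -
    have "filter_rel H G f `` {P} = {Q \<in> irreducible_filters H. preimage P \<subseteq> Q}"
      using P by (auto simp: filter_rel_def)
    then show ?thesis using up preimage_irreducible[OF P] by blast
  qed
  then show ?thesis using U by (auto simp: star_hom_def)
qed

lemma star_hom_phi:
  assumes "a \<in> carrier H"
  shows "star_hom H G f (phi H a) = phi G (f a)"
  unfolding star_hom_apply[OF phi_in_star[OF assms]]
  using assms preimage_irreducible by (auto simp: phi_def)

text \<open>The lifting of inclusions along the preimage map is what makes \<open>star_hom\<close> preserve implication.\<close>

lemma star_hom_imp:
  assumes U: "U \<in> carrier (star H)" and V: "V \<in> carrier (star H)"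
  shows "star_hom H G f (U \<leadsto>\<^bsub>star H\<^esub> V) = star_hom H G f U \<leadsto>\<^bsub>star G\<^esub> star_hom H G f V"
proof -
  have UV: "U \<leadsto>\<^bsub>star H\<^esub> V \<in> carrier (star H)"
    using U V by (simp add: star_carrier heyting_generated.imp)
  have "preimage P \<in> U \<leadsto>\<^bsub>star H\<^esub> V \<longleftrightarrow>
      (\<forall>R\<in>irreducible_filters G. P \<subseteq> R \<longrightarrow> preimage R \<in> U \<longrightarrow> preimage R \<in> V)"
    if P: "P \<in> irreducible_filters G" for P
  proof
    assume imp: "preimage P \<in> U \<leadsto>\<^bsub>star H\<^esub> V"
    show "\<forall>R\<in>irreducible_filters G. P \<subseteq> R \<longrightarrow> preimage R \<in> U \<longrightarrow> preimage R \<in> V"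
    proof (intro ballI impI)
      fix R assume R: "R \<in> irreducible_filters G" "P \<subseteq> R" "preimage R \<in> U"
      then have "preimage P \<subseteq> preimage R" by blast
      then show "preimage R \<in> V" using imp R preimage_irreducible[OF R(1)] by (simp add: upset_imp)
    qed
  next
    assume R: "\<forall>R\<in>irreducible_filters G. P \<subseteq> R \<longrightarrow> preimage R \<in> U \<longrightarrow> preimage R \<in> V"
    have "Q \<in> V" if Q: "Q \<in> irreducible_filters H" "preimage P \<subseteq> Q" "Q \<in> U" for Q
      using preimage_lifting[OF P Q(1,2)] R Q(3) by blast
    then show "preimage P \<in> U \<leadsto>\<^bsub>star H\<^esub> V" using preimage_irreducible[OF P] by (simp add: upset_imp)
  qed
  then show ?thesis
    unfolding star_hom_apply[OF UV] star_hom_apply[OF U] star_hom_apply[OF V]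
    by (auto simp: upset_imp)
qed

lemma star_hom_ops:
  assumes U: "U \<in> carrier (star H)" and V: "V \<in> carrier (star H)"
  shows "star_hom H G f (U \<inter> V) = star_hom H G f U \<inter> star_hom H G f V"
    and "star_hom H G f (U \<union> V) = star_hom H G f U \<union> star_hom H G f V"
proof -
  have "U \<inter> V \<in> carrier (star H)" "U \<union> V \<in> carrier (star H)"
    using heyting_generated.meet[OF U[unfolded star_carrier] V[unfolded star_carrier]]
      heyting_generated.join[OF U[unfolded star_carrier] V[unfolded star_carrier]]
    by (simp_all add: star_carrier)
  then show "star_hom H G f (U \<inter> V) = star_hom H G f U \<inter> star_hom H G f V"
    and "star_hom H G f (U \<union> V) = star_hom H G f U \<union> star_hom H G f V"
    using U V by (auto simp: star_hom_apply)
qed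

lemma star_hom_bounds:
  "star_hom H G f (irreducible_filters H) = irreducible_filters G" "star_hom H G f {} = {}"
proof -
  have "irreducible_filters H \<in> carrier (star H)" "{} \<in> carrier (star H)"
    using heyting_generated.one[of "upset_algebra (irreducible_filters H)"]
      heyting_generated.zero[of "upset_algebra (irreducible_filters H)"] by (simp_all add: star_carrier)
  then show "star_hom H G f (irreducible_filters H) = irreducible_filters G" "star_hom H G f {} = {}"
    using preimage_irreducible by (auto simp: star_hom_apply)
qed

lemma star_hom_closed:
  assumes "U \<in> carrier (star H)"
  shows "star_hom H G f U \<in> carrier (star G)"
proof -
  interpret SG: prelinear_heyting_algebra "star G"
    by (rule star_prelinear[OF G.bounded_prelinear_hilbert_algebra_axioms])
  show ?thesis
    using assms unfolding star_carrier[of H]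
  proof induction
    case (gen x)
    then show ?case using star_hom_phi phi_in_star[OF f_closed] by auto
  next
    case one
    then show ?case using SG.one_closed by (simp add: star_hom_bounds)
  next
    case zero
    then show ?case using SG.zero_closed by (simp add: star_hom_bounds)
  next
    case (meet x y)
    then show ?case using SG.meet_closed[OF meet.IH] by (simp add: star_hom_ops star_carrier[of H])
  next
    case (join x y)
    then show ?case using SG.join_closed[OF join.IH] by (simp add: star_hom_ops star_carrier[of H])
  next
    case (imp x y)
    then show ?case
      using SG.imp_closed[OF imp.IH] star_hom_imp[of x y] by (simp add: star_carrier[of H])
  qed
qed

lemma star_hom_phey: "star_hom H G f \<in> phey_hom (star H) (star G)"
  unfolding phey_hom_def
proof (intro CollectI conjI ballI)
  show "star_hom H G f \<in> carrier (star H) \<rightarrow>\<^sub>E carrier (star G)"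
    using star_hom_closed by (auto simp: star_hom_def)
qed (simp_all only: star_ops(1-4) star_hom_ops star_hom_bounds star_hom_imp)

end

lemma star_hom_id:
  assumes "bounded_prelinear_hilbert_algebra H"
  shows "star_hom H H (id_hom H) = id_hom (star H)"
proof
  interpret bounded_prelinear_hilbert_algebra H by fact
  interpret phil_morphism H H "id_hom H" by unfold_locales (rule id_hom_phil[OF assms])
  fix U show "star_hom H H (id_hom H) U = id_hom (star H) U"
  proof (cases "U \<in> carrier (star H)")
    case True
    have "preimage P = P" if "P \<in> irreducible_filters H" for P
      using filter_sub[OF irreducible_filterD[OF that]] by auto
    then have "star_hom H H (id_hom H) U = {P \<in> irreducible_filters H. P \<in> U}"
      unfolding star_hom_apply[OF True] by auto
    then show ?thesis using star_upset[OF True] True by (auto simp: upset_carrier)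
  qed (simp add: star_hom_def)
qed

lemma star_hom_compose:
  assumes "bounded_prelinear_hilbert_algebra H1" "bounded_prelinear_hilbert_algebra H2"
    "bounded_prelinear_hilbert_algebra H3" "f \<in> phil_hom H1 H2" "g \<in> phil_hom H2 H3"
  shows "star_hom H1 H3 (compose (carrier H1) g f)
    = compose (carrier (star H1)) (star_hom H2 H3 g) (star_hom H1 H2 f)"
proof
  let ?gf = "compose (carrier H1) g f"
  interpret f: phil_morphism H1 H2 f using assms by (simp add: phil_morphism_def phil_morphism_axioms_def)
  interpret g: phil_morphism H2 H3 g using assms by (simp add: phil_morphism_def phil_morphism_axioms_def)
  interpret gf: phil_morphism H1 H3 ?gf
    using assms compose_phil by (simp add: phil_morphism_def phil_morphism_axioms_def) blast
  fix U show "star_hom H1 H3 ?gf U = compose (carrier (star H1)) (star_hom H2 H3 g) (star_hom H1 H2 f) U"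
  proof (cases "U \<in> carrier (star H1)")
    case True
    have "gf.preimage P = f.preimage (g.preimage P)" for P
      using f.f_closed by (auto simp: compose_def)
    then have "star_hom H1 H3 ?gf U = {P \<in> irreducible_filters H3. f.preimage (g.preimage P) \<in> U}"
      by (simp only: gf.star_hom_apply[OF True])
    also have "\<dots> = star_hom H2 H3 g (star_hom H1 H2 f U)"
      unfolding g.star_hom_apply[OF f.star_hom_closed[OF True]]
      unfolding f.star_hom_apply[OF True]
      using g.preimage_irreducible by blast
    finally show ?thesis using True by (simp add: compose_def)
  qed (simp add: star_hom_def compose_def)
qed

section \<open>Every prelinear Heyting algebra is its own representation\<close>

lemma phey_hom_closed: "h \<in> phey_hom A B \<Longrightarrow> x \<in> carrier A \<Longrightarrow> h x \<in> carrier B"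
  by (auto simp: phey_hom_def)

lemma phey_hom_inverse:
  assumes "prelinear_heyting_algebra A" and h: "h \<in> phey_hom A B"
    and bij: "bij_betw h (carrier A) (carrier B)"
  shows "restrict (the_inv_into (carrier A) h) (carrier B) \<in> phey_hom B A"
proof -
  interpret A: prelinear_heyting_algebra A by fact
  let ?g = "the_inv_into (carrier A) h"
  have inj: "inj_on h (carrier A)" and img: "h ` carrier A = carrier B"
    using bij by (auto simp: bij_betw_def)
  have gh: "?g (h x) = x" if "x \<in> carrier A" for x by (rule the_inv_into_f_f[OF inj that])
  have g: "?g y \<in> carrier A" if "y \<in> carrier B" for y using that gh unfolding img[symmetric] by auto
  have hg: "h (?g y) = y" if "y \<in> carrier B" for y using that gh unfolding img[symmetric] by auto
  note hom = h[unfolded phey_hom_def]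
  have one: "\<^bold>1\<^bsub>B\<^esub> = h \<^bold>1\<^bsub>A\<^esub>" and zero: "\<^bold>0\<^bsub>B\<^esub> = h \<^bold>0\<^bsub>A\<^esub>" using hom by simp_all
  have ops: "x \<sqinter>\<^bsub>B\<^esub> y = h (?g x \<sqinter>\<^bsub>A\<^esub> ?g y)" "x \<squnion>\<^bsub>B\<^esub> y = h (?g x \<squnion>\<^bsub>A\<^esub> ?g y)"
    "x \<leadsto>\<^bsub>B\<^esub> y = h (?g x \<leadsto>\<^bsub>A\<^esub> ?g y)" if "x \<in> carrier B" "y \<in> carrier B" for x y
    using hom g hg that by simp_all
  show ?thesis
    unfolding phey_hom_def
    using g gh phey_hom_closed[OF h] A.one_closed A.zero_closed A.meet_closed A.join_closed A.imp_closed
    by (auto simp: one zero ops)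
qed

context
  fixes G :: "'d heyting"
  assumes G: "prelinear_heyting_algebra G"
begin

interpretation G: prelinear_heyting_algebra G by (rule G)
interpretation FG: bounded_prelinear_hilbert_algebra "forget G" by (rule forget_bounded_prelinear[OF G])

lemma phi_meet:
  assumes "x \<in> carrier G" "y \<in> carrier G"
  shows "phi (forget G) (x \<sqinter>\<^bsub>G\<^esub> y) = phi (forget G) x \<inter> phi (forget G) y"
proof -
  have "x \<sqinter>\<^bsub>G\<^esub> y \<in> P \<longleftrightarrow> x \<in> P \<and> y \<in> P" if P: "implicative_filter (forget G) P" for P
  proof -
    have cl: "x \<sqinter>\<^bsub>G\<^esub> y \<in> carrier G" "y \<leadsto>\<^bsub>G\<^esub> (x \<sqinter>\<^bsub>G\<^esub> y) \<in> carrier G"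
      using assms by (simp_all add: G.imp_closed G.meet_closed)
    have "x \<leadsto>\<^bsub>G\<^esub> (y \<leadsto>\<^bsub>G\<^esub> (x \<sqinter>\<^bsub>G\<^esub> y)) = \<^bold>1\<^bsub>G\<^esub>" "(x \<sqinter>\<^bsub>G\<^esub> y) \<leadsto>\<^bsub>G\<^esub> x = \<^bold>1\<^bsub>G\<^esub>" "(x \<sqinter>\<^bsub>G\<^esub> y) \<leadsto>\<^bsub>G\<^esub> y = \<^bold>1\<^bsub>G\<^esub>"
      using assms cl by (simp_all add: G.imp_eq_one_iff G.le_imp_iff G.meet_idem G.meet_le1 G.meet_le2)
    then have imps: "x \<leadsto>\<^bsub>G\<^esub> (y \<leadsto>\<^bsub>G\<^esub> (x \<sqinter>\<^bsub>G\<^esub> y)) \<in> P" "(x \<sqinter>\<^bsub>G\<^esub> y) \<leadsto>\<^bsub>G\<^esub> x \<in> P" "(x \<sqinter>\<^bsub>G\<^esub> y) \<leadsto>\<^bsub>G\<^esub> y \<in> P"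
      using filter_one[OF P] by simp_all
    show ?thesis
    proof (intro iffI conjI)
      assume xy: "x \<in> P \<and> y \<in> P"
      then have "y \<leadsto>\<^bsub>G\<^esub> (x \<sqinter>\<^bsub>G\<^esub> y) \<in> P" using filter_mp[OF P, of x] imps cl by simp
      then show "x \<sqinter>\<^bsub>G\<^esub> y \<in> P" using filter_mp[OF P, of y] xy cl by simp
    qed (use filter_mp[OF P, of "x \<sqinter>\<^bsub>G\<^esub> y"] imps assms in simp_all)
  qed
  then show ?thesis using FG.irreducible_filterD by (auto simp: phi_def)
qed

text \<open>In a filter containing \<open>x \<leadsto> y\<close> the join \<open>x \<squnion> y\<close> amounts to
  \<open>y\<close>, so linearity makes an irreducible filter prime.\<close>

lemma phi_join:
  assumes xy: "x \<in> carrier G" "y \<in> carrier G"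
  shows "phi (forget G) (x \<squnion>\<^bsub>G\<^esub> y) = phi (forget G) x \<union> phi (forget G) y"
proof -
  have down: "y \<in> P"
    if P: "implicative_filter (forget G) P" and "x \<in> carrier G" "y \<in> carrier G" "x \<leadsto>\<^bsub>G\<^esub> y \<in> P" "x \<squnion>\<^bsub>G\<^esub> y \<in> P"
    for x y P
  proof -
    let ?i = "x \<leadsto>\<^bsub>G\<^esub> y"
    have cl: "?i \<in> carrier G" "x \<squnion>\<^bsub>G\<^esub> y \<in> carrier G" "?i \<leadsto>\<^bsub>G\<^esub> y \<in> carrier G" "(x \<squnion>\<^bsub>G\<^esub> y) \<leadsto>\<^bsub>G\<^esub> y \<in> carrier G"
      using that by (simp_all add: G.imp_closed G.join_closed)
    have "?i \<sqinter>\<^bsub>G\<^esub> x \<sqinter>\<^bsub>G\<^esub> y = ?i \<sqinter>\<^bsub>G\<^esub> x"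
      using that(2,3) cl G.le_imp_iff[of ?i x y] by (simp add: G.meet_idem)
    then have "x \<sqinter>\<^bsub>G\<^esub> (?i \<leadsto>\<^bsub>G\<^esub> y) = x" using that(2,3) cl by (simp add: G.le_imp_iff G.meet_comm)
    moreover have "y \<sqinter>\<^bsub>G\<^esub> (?i \<leadsto>\<^bsub>G\<^esub> y) = y" using that(2,3) cl by (simp add: G.le_imp_iff G.meet_le1)
    ultimately have "(x \<squnion>\<^bsub>G\<^esub> y) \<sqinter>\<^bsub>G\<^esub> (?i \<leadsto>\<^bsub>G\<^esub> y) = x \<squnion>\<^bsub>G\<^esub> y" using that(2,3) cl by (simp add: G.join_le)
    then have "(x \<squnion>\<^bsub>G\<^esub> y) \<leadsto>\<^bsub>G\<^esub> (?i \<leadsto>\<^bsub>G\<^esub> y) \<in> P"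
      using cl filter_one[OF P] by (simp add: G.imp_eq_one_iff[symmetric])
    then show ?thesis
      using filter_mp[OF P, of "x \<squnion>\<^bsub>G\<^esub> y" "?i \<leadsto>\<^bsub>G\<^esub> y"] filter_mp[OF P, of ?i y] that cl by simp
  qed
  have "x \<squnion>\<^bsub>G\<^esub> y \<in> P \<longleftrightarrow> x \<in> P \<or> y \<in> P" if irr: "P \<in> irreducible_filters (forget G)" for P
  proof
    have P: "implicative_filter (forget G) P" and lin: "linear_filter (forget G) P"
      using irr by (simp_all add: FG.irreducible_iff)
    show "x \<in> P \<or> y \<in> P" if "x \<squnion>\<^bsub>G\<^esub> y \<in> P"
      using linear_filterD[OF lin, of x y] down[OF P, of x y] down[OF P, of y x] that xy
      by (auto simp: G.join_comm)
    show "x \<squnion>\<^bsub>G\<^esub> y \<in> P" if "x \<in> P \<or> y \<in> P"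
    proof -
      have "x \<leadsto>\<^bsub>G\<^esub> (x \<squnion>\<^bsub>G\<^esub> y) = \<^bold>1\<^bsub>G\<^esub>" "y \<leadsto>\<^bsub>G\<^esub> (x \<squnion>\<^bsub>G\<^esub> y) = \<^bold>1\<^bsub>G\<^esub>"
        using xy by (simp_all add: G.imp_eq_one_iff G.join_closed G.meet_absorb G.le_join2)
      then show ?thesis
        using that filter_mp[OF P, of x "x \<squnion>\<^bsub>G\<^esub> y"] filter_mp[OF P, of y "x \<squnion>\<^bsub>G\<^esub> y"] filter_one[OF P] xy
        by (auto simp: G.join_closed)
    qed
  qed
  then show ?thesis by (auto simp: phi_def)
qed

lemma star_forget_carrier: "carrier (star (forget G)) = phi (forget G) ` carrier G"
proof (intro equalityI subsetI)
  fix U assume "U \<in> carrier (star (forget G))"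
  then show "U \<in> phi (forget G) ` carrier G"
    unfolding star_carrier
  proof induction
    case one
    show ?case using FG.phi_one G.one_closed by (simp add: image_iff) blast
  next
    case zero
    show ?case using FG.phi_zero G.zero_closed by (simp add: image_iff) blast
  next
    case (meet x y)
    then obtain a b where "x = phi (forget G) a" "y = phi (forget G) b" "a \<in> carrier G" "b \<in> carrier G" by blast
    then show ?case by (intro image_eqI[of _ _ "a \<sqinter>\<^bsub>G\<^esub> b"]) (simp_all add: phi_meet G.meet_closed)
  next
    case (join x y)
    then obtain a b where "x = phi (forget G) a" "y = phi (forget G) b" "a \<in> carrier G" "b \<in> carrier G" by blast
    then show ?case by (intro image_eqI[of _ _ "a \<squnion>\<^bsub>G\<^esub> b"]) (simp_all add: phi_join G.join_closed)
  next
    case (imp x y)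
    then obtain a b where ab: "x = phi (forget G) a" "y = phi (forget G) b" "a \<in> carrier G" "b \<in> carrier G" by blast
    then show ?case using FG.phi_imp[of a b]
      by (intro image_eqI[of _ _ "a \<leadsto>\<^bsub>G\<^esub> b"]) (simp_all add: G.imp_closed)
  qed simp
qed (auto simp: phi_in_star)

lemma phi_bij: "bij_betw (restrict (phi (forget G)) (carrier G)) (carrier G) (carrier (star (forget G)))"
  using FG.phi_inj by (simp add: bij_betw_def star_forget_carrier inj_on_restrict_eq)

lemma phi_phey: "restrict (phi (forget G)) (carrier G) \<in> phey_hom G (star (forget G))"
  unfolding phey_hom_def star_forget_carrier
  using FG.phi_imp FG.phi_one FG.phi_zero
  by (auto simp: phi_meet phi_join G.meet_closed G.join_closed G.imp_closed G.one_closed G.zero_closed)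

end

section \<open>The adjunction\<close>

lemma forget_hom_phil:
  assumes "h \<in> phey_hom A B"
  shows "forget_hom h \<in> phil_hom (forget A) (forget B)"
  using assms by (simp add: phey_hom_def phil_hom_def forget_hom_def)

lemma star_transpose_eq_compose:
  "star_transpose H h = compose (carrier H) (forget_hom h) (restrict (phi H) (carrier H))"
  by (rule ext) (simp add: star_transpose_def compose_def)

lemma star_transpose_phil:
  assumes "bounded_prelinear_hilbert_algebra H" "h \<in> phey_hom (star H) G"
  shows "star_transpose H h \<in> phil_hom H (forget G)"
  unfolding star_transpose_eq_compose
  by (rule compose_phil[OF assms(1) phi_unit[OF assms(1)] forget_hom_phil[OF assms(2)]])

lemma phey_hom_generated_eqI:
  assumes h: "h \<in> phey_hom (star H) G" and k: "k \<in> phey_hom (star H) G"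
    and eq: "\<And>a. a \<in> carrier H \<Longrightarrow> h (phi H a) = k (phi H a)"
  shows "h = k"
proof (rule extensionalityI)
  show "h \<in> extensional (carrier (star H))" "k \<in> extensional (carrier (star H))"
    using h k by (auto simp: phey_hom_def PiE_def)
  note hom = h[unfolded phey_hom_def star_carrier] k[unfolded phey_hom_def star_carrier]
  fix U assume "U \<in> carrier (star H)"
  then show "h U = k U"
    unfolding star_carrier
  proof induction
    case (gen x)
    then show ?case using eq by auto
  next
    case one
    show ?case using hom by simp
  next
    case zero
    show ?case using hom by simp
  next
    case (meet x y)
    then show ?case using hom by simp
  next
    case (join x y)
    then show ?case using hom by simp
  next
    case (imp x y)
    then show ?case using hom by simp
  qed
qed

text \<open>A morphism \<open>f\<close> into a reduct \<open>forget G\<close> is the transpose of \<open>star_hom\<close> of \<open>f\<close> followed by the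
  inverse of the isomorphism \<open>phi\<close> from \<open>G\<close> onto its own representation.\<close>

lemma star_transpose_surj:
  assumes H: "bounded_prelinear_hilbert_algebra H" and G: "prelinear_heyting_algebra G"
    and f: "f \<in> phil_hom H (forget G)"
  shows "\<exists>h\<in>phey_hom (star H) G. star_transpose H h = f"
proof -
  interpret G: bounded_prelinear_hilbert_algebra "forget G" by (rule forget_bounded_prelinear[OF G])
  interpret phil_morphism H "forget G" f
    using H f G.bounded_prelinear_hilbert_algebra_axioms
    by (simp add: phil_morphism_def phil_morphism_axioms_def)
  let ?iso = "restrict (phi (forget G)) (carrier G)"
  let ?inv = "restrict (the_inv_into (carrier G) ?iso) (carrier (star (forget G)))"
  let ?h = "compose (carrier (star H)) ?inv (star_hom H (forget G) f)"
  have inv: "?inv \<in> phey_hom (star (forget G)) G"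
    by (rule phey_hom_inverse[OF G phi_phey[OF G] phi_bij[OF G]])
  have "?h \<in> phey_hom (star H) G"
    by (rule compose_phey[OF star_prelinear[OF H] star_hom_phey inv])
  moreover have "star_transpose H ?h = f"
  proof (rule extensionalityI)
    show "star_transpose H ?h \<in> extensional (carrier H)" by (simp add: star_transpose_def compose_def)
    show "f \<in> extensional (carrier H)" using f by (auto simp: phil_hom_def PiE_def)
    fix a assume a: "a \<in> carrier H"
    then have fa: "f a \<in> carrier G" using f_closed by simp
    have "star_transpose H ?h a = the_inv_into (carrier G) ?iso (phi (forget G) (f a))"
      using a fa by (simp add: star_transpose_def forget_hom_def compose_def phi_in_star star_hom_phi)
    also have "\<dots> = the_inv_into (carrier G) ?iso (?iso (f a))" using fa by simp
    also have "\<dots> = f a"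
      by (rule the_inv_into_f_f[OF bij_betw_imp_inj_on[OF phi_bij[OF G]] fa])
    finally show "star_transpose H ?h a = f a" .
  qed
  ultimately show ?thesis by blast
qed

lemma star_transpose_bij:
  assumes H: "bounded_prelinear_hilbert_algebra H" and G: "prelinear_heyting_algebra G"
  shows "bij_betw (star_transpose H) (phey_hom (star H) G) (phil_hom H (forget G))"
proof (rule bij_betwI')
  fix h k assume hk: "h \<in> phey_hom (star H) G" "k \<in> phey_hom (star H) G"
  show "star_transpose H h = star_transpose H k \<longleftrightarrow> h = k"
  proof
    assume "star_transpose H h = star_transpose H k"
    then have "star_transpose H h a = star_transpose H k a" for a by simp
    then show "h = k"
      using phey_hom_generated_eqI[OF hk] by (simp add: star_transpose_def forget_hom_def compose_def) metis
  qed simp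
next
  fix h assume "h \<in> phey_hom (star H) G"
  then show "star_transpose H h \<in> phil_hom H (forget G)" by (rule star_transpose_phil[OF H])
next
  fix f assume "f \<in> phil_hom H (forget G)"
  then show "\<exists>h\<in>phey_hom (star H) G. f = star_transpose H h" using star_transpose_surj[OF H G] by metis
qed

text \<open>Naturality reduces to that of \<open>phi\<close>, which is \<open>star_hom_phi\<close>.\<close>

lemma star_transpose_natural:
  assumes "bounded_prelinear_hilbert_algebra H1" "bounded_prelinear_hilbert_algebra H2"
    and "f \<in> phil_hom H1 H2"
  shows "star_transpose H1
      (compose (carrier (star H1)) k (compose (carrier (star H1)) h (star_hom H1 H2 f)))
    = compose (carrier H1) (forget_hom k) (compose (carrier H1) (star_transpose H2 h) f)"
proof -
  interpret phil_morphism H1 H2 f using assms by (simp add: phil_morphism_def phil_morphism_axioms_def)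
  show ?thesis
    by (rule ext) (simp add: star_transpose_def forget_hom_def compose_def phi_in_star star_hom_phi f_closed)
qed

theorem theorem3:
  fixes H1 :: "'a bounded_hilbert" and H2 :: "'b bounded_hilbert" and H3 :: "'c bounded_hilbert"
    and G1 :: "'d heyting" and G2 :: "'e heyting" and G3 :: "'f heyting"
  assumes "bounded_prelinear_hilbert_algebra H1" "bounded_prelinear_hilbert_algebra H2"
      "bounded_prelinear_hilbert_algebra H3"
    and "prelinear_heyting_algebra G1" "prelinear_heyting_algebra G2" "prelinear_heyting_algebra G3"
  shows
    \<comment> \<open>\<open>star\<close> is a functor\<close>
    "(prelinear_heyting_algebra (star H1) \<and>
      (\<forall>f\<in>phil_hom H1 H2. star_hom H1 H2 f \<in> phey_hom (star H1) (star H2)) \<and>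
      star_hom H1 H1 (id_hom H1) = id_hom (star H1) \<and>
      (\<forall>f\<in>phil_hom H1 H2. \<forall>g\<in>phil_hom H2 H3.
         star_hom H1 H3 (compose (carrier H1) g f)
         = compose (carrier (star H1)) (star_hom H2 H3 g) (star_hom H1 H2 f))) \<and>
     \<comment> \<open>\<open>forget\<close> is a functor\<close>
     (bounded_prelinear_hilbert_algebra (forget G1) \<and>
      (\<forall>h\<in>phey_hom G1 G2. forget_hom h \<in> phil_hom (forget G1) (forget G2)) \<and>
      forget_hom (id_hom G1) = id_hom (forget G1) \<and>
      (\<forall>h\<in>phey_hom G1 G2. \<forall>k\<in>phey_hom G2 G3.
         forget_hom (compose (carrier G1) k h)
         = compose (carrier (forget G1)) (forget_hom k) (forget_hom h))) \<and>
     \<comment> \<open>\<open>star_transpose\<close> is a bijection of hom-sets, natural in both arguments\<close>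
     (bij_betw (star_transpose H1) (phey_hom (star H1) G1) (phil_hom H1 (forget G1)) \<and>
      (\<forall>f\<in>phil_hom H1 H2. \<forall>h\<in>phey_hom (star H2) G1. \<forall>k\<in>phey_hom G1 G2.
         star_transpose H1
           (compose (carrier (star H1)) k (compose (carrier (star H1)) h (star_hom H1 H2 f)))
         = compose (carrier H1) (forget_hom k)
             (compose (carrier H1) (star_transpose H2 h) f)))"
proof (intro conjI ballI)
  fix f assume "f \<in> phil_hom H1 H2"
  then interpret phil_morphism H1 H2 f using assms by (simp add: phil_morphism_def phil_morphism_axioms_def)
  show "star_hom H1 H2 f \<in> phey_hom (star H1) (star H2)" by (rule star_hom_phey)
next
  show "forget_hom (id_hom G1) = id_hom (forget G1)" by (simp add: forget_hom_def)
next
  fix h k show "forget_hom (compose (carrier G1) k h) = compose (carrier (forget G1)) (forget_hom k) (forget_hom h)"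
    by (simp add: forget_hom_def)
qed (use assms in \<open>simp_all add: star_prelinear star_hom_id star_hom_compose forget_bounded_prelinear
      forget_hom_phil star_transpose_bij star_transpose_natural\<close>)

end
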